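(* Let $\sin 2\theta=Z/(2m)$ with $|Z|<2m$ (non-BPS case), $|\theta|<\pi/4$, $c=\cos\theta$, $s=\sin\theta$. Let $\mathcal A$ be a quantity that (1) is invariant under all little-group transformations of the three external particles and (2) is invariant under supersymmetry, i.e. $Q^A_\alpha\mathcal A=0$ and $\tilde Q_{\dot\alpha A}\mathcal A=0$ for all $A,\alpha,\dot\alpha$. Then $\mathcal A$ is a linear combination of two solutions, $$\mathcal A=\alpha_1\,S^{(1)}(\theta)+\alpha_2\,S^{(2)}(\theta),$$ with coefficients $\alpha_1,\alpha_2$ not fixed by these conditions, where for $a=1,2$ $$S^{(a)}(\theta)=C^{(a)}\,\delta^1\delta^2\Big\{f^{(a)}+\eta_P^A\,g^{(a)}_A+\tfrac12\eta_P^A\eta_{PA}\,h^{(a)}\Big\},\qquad C^{(1)}=c^2,\quad C^{(2)}=-x,$$ $$h^{(1)}=1-\frac{2s}{c}(\mathcal H\cdot\bar{\mathcal H})+\frac{s^2}{c^2}(\mathcal H\cdot\mathcal H)(\bar{\mathcal H}\cdot\bar{\mathcal H}),\quad g^{(1)}_A=\frac1c\mathcal H_A+\frac{s}{c^2}(\mathcal H\cdot\mathcal H)\bar{\mathcal H}_A,\quad f^{(1)}=\frac1{c^2}(\mathcal H\cdot\mathcal H),$$ $$h^{(2)}=(\bar{\mathcal H}\cdot\bar{\mathcal H}),\quad g^{(2)}_A=c\,\mathcal H_A(\bar{\mathcal H}\cdot\bar{\mathcal H})+s\,\bar{\mathcal H}_A,\quad f^{(2)}=s^2+2cs(\mathcal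 H\cdot\bar{\mathcal H})+c^2(\mathcal H\cdot\mathcal H)(\bar{\mathcal H}\cdot\bar{\mathcal H}).$$ In Lorentz covariant form, with $E_{BC}=(\eta_{1B}\cdot\eta_{1C})-(\eta_{2B}\cdot\eta_{2C})$ and $E^{BC}=(\eta_1^B\cdot\eta_1^C)-(\eta_2^B\cdot\eta_2^C)$, $$\begin{aligned}S^{(1)}(\theta)=&\ \tfrac{c^2}{4}\langle\mathcal Q^A\mathcal Q_P^B\rangle\langle\mathcal Q_A\mathcal Q_{PB}\rangle+\tfrac{cs}{6x}\langle\mathcal Q^A\mathcal Q^B\rangle[\tilde{\mathcal Q}_A\tilde{\mathcal Q}_B](\eta_P\cdot\eta_P)+\tfrac{s^2}{12x^2}[\tilde{\mathcal Q}^A\tilde{\mathcal Q}_P^B][\tilde{\mathcal Q}_A\tilde{\mathcal Q}_{PB}]\,E^{CD}E_{CD}\\&+\tfrac c3\langle\mathcal Q^A\mathcal Q^B\rangle\langle\mathcal Q_A\mathcal Q_{PB}\rangle-\tfrac{2s}{9x}\langle\mathcal Q^A\mathcal Q^B\rangle[\tilde{\mathcal Q}_A\tilde{\mathcal Q}_P^C]\,E_{BC}+\tfrac1{12}\langle\mathcal Q^A\mathcal Q^B\rangle\langle\mathcal Q_A\mathcal Q_B\rangle,\end{aligned}$$ $$\begin{aligned}S^{(2)}(\theta)=&\ \tfrac1{12x}[\tilde{\mathcal Q}^A\tilde{\mathcal Q}^B][\tilde{\mathcal Q}_A\tilde{\mathcal Q}_B](\eta_P\cdot\eta_P)-\tfrac{2c}{9x}[\tilde{\mathcal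 Q}^A\tilde{\mathcal Q}^B][\tilde{\mathcal Q}_A\tilde{\mathcal Q}_P^C]\,E_{BC}+\tfrac s3[\tilde{\mathcal Q}^A\tilde{\mathcal Q}^B]\langle\mathcal Q_A\mathcal Q_{PB}\rangle\\&+\tfrac{s^2x}{2}\langle\mathcal Q^AP\rangle\langle\mathcal Q_AP\rangle+\tfrac{cs}{6}\langle\mathcal Q^A\mathcal Q^B\rangle[\tilde{\mathcal Q}_A\tilde{\mathcal Q}_B]+\tfrac{c^2}{6x}[\tilde{\mathcal Q}^AP][\tilde{\mathcal Q}_AP]\,E^{BC}E_{BC}.\end{aligned}$$
   Context: Setting: $\mathcal N=2$ supersymmetric three-point amplitude of two massive multiplets (legs $i=1,2$) of equal mass $m$ and central charges $Z,-Z$, and one massless multiplet (leg $P$). $\mathcal A$ is a polynomial in the Grassmann variables below with coefficients depending on the kinematic spinors; its R-indices are taken to be fully contracted. Conventions. Two-valued indices are moved with $\epsilon^{12}=-\epsilon^{21}=1$, $\epsilon_{12}=-\epsilon_{21}=-1$. Repeated indices are summed. Undotted spinors: $\lambda^\alpha=\epsilon^{\alpha\beta}\lambda_\beta$, $\langle\lambda\mu\rangle=\lambda^\alpha\mu_\alpha$. Dotted spinors: $\tilde\mu^{\dot\alpha}=\epsilon^{\dot\alpha\dot\beta}\tilde\mu_{\dot\beta}$, $[\lambda\mu]=\tilde\lambda_{\dot\alpha}\tilde\mu^{\dot\alpha}$. Kinematics. $m>0$. For $i=1,2$ there are spinors $\lambda^I_{i\alpha},\tilde\lambda^I_{i\dot\alpha}$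 (written $\mathbf i^I$ in brackets), $I=1,2$ the $SU(2)$ little-group index, with $\langle\mathbf i^I\mathbf i^J\rangle=-m\epsilon^{IJ}$, $[\mathbf i^I\mathbf i^J]=m\epsilon^{IJ}$ and $p_{i\alpha\dot\alpha}=\lambda^I_{i\alpha}\epsilon_{IJ}\tilde\lambda^J_{i\dot\alpha}$. For the massless leg, $P_{\alpha\dot\alpha}=\lambda_{P\alpha}\tilde\lambda_{P\dot\alpha}$ (spinors written $P$ in brackets), with $U(1)$ little group $\lambda_P\to t^{-1}\lambda_P$, $\tilde\lambda_P\to t\tilde\lambda_P$, $\eta_P\to t\,\eta_P$. Momentum conservation: $p_1+p_2+P=0$. The factor $x$ is defined by $x\lambda_{P\alpha}=\frac1m p_{1\alpha\dot\alpha}\tilde\lambda_P^{\dot\alpha}$. Grassmann variables: $\eta^A_{iI}$ and $\eta^A_P$, with R-index $A=1,2$; $\eta_{iIA}=\epsilon_{AB}\eta^B_{iI}$, $\eta_{PA}=\epsilon_{AB}\eta_P^B$. $\frac{\partial}{\partial\eta_i^{IA}}=-\epsilon_{IJ}\frac{\partial}{\partial\eta^A_{iJ}}$, $\frac{\partial}{\partial\eta^I_{iA}}=\epsilon_{IJ}\epsilon^{AB}\frac{\partial}{\partial\eta^B_{iJ}}$. Also $\eta_i^A\cdot\eta_i^B=-\frac12\epsilon^{IJ}\eta^A_{iI}\eta^B_{iJ}$ (similarly with lowered $A,B$), $\eta_P\cdot\eta_P=\frac12\eta_P^A\eta_{PA}$. Supercharges, with $\sigma_1=1,\sigma_2=-1$: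 $$Q^A_\alpha=\sum_{i=1}^2\lambda^I_{i\alpha}\Big(c\,\eta^A_{iI}+s\,\sigma_i\frac{\partial}{\partial\eta^I_{iA}}\Big)+\lambda_{P\alpha}\eta_P^A,\qquad\tilde Q_{\dot\alpha A}=\sum_{i=1}^2\tilde\lambda^I_{i\dot\alpha}\Big(c\frac{\partial}{\partial\eta_i^{IA}}-s\,\sigma_i\eta_{iIA}\Big)+\tilde\lambda_{P\dot\alpha}\frac{\partial}{\partial\eta_P^A}.$$ Building blocks, with reference spinors $\zeta,\xi$ satisfying $\langle\zeta P\rangle\neq0$, $[\xi P]\ne0$ (dependence on them drops out when multiplied by $\delta^1\delta^2$): $$\delta^A=\sum_i\langle P\mathbf i^I\rangle\eta^A_{iI},\quad\mathcal H^A=\frac1{\langle\zeta P\rangle}\sum_i\langle\zeta\mathbf i^I\rangle\eta^A_{iI},\quad\bar{\mathcal H}^A=\frac1{[\xi P]}\sum_i[\xi\mathbf i^I]\sigma_i\eta^A_{iI},$$ $\mathcal H_A=\epsilon_{AB}\mathcal H^B$, $\bar{\mathcal H}_A=\epsilon_{AB}\bar{\mathcal H}^B$, $(\mathcal H\cdot\mathcal H)=\frac12\mathcal H^A\mathcal H_A$, $(\bar{\mathcal H}\cdot\bar{\mathcal H})=\frac12\bar{\mathcal H}^A\bar{\mathcal H}_A$, $(\mathcal H\cdot\bar{\mathcal H})=\frac12\mathcal H^A\bar{\mathcal H}_A$. Covariant components: $\mathcal Q^A_\alpha=\lambda^I_{1\alpha}\eta^A_{1I}+\lambda^I_{2\alpha}\eta^A_{2I}$,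 $\tilde{\mathcal Q}^A_{\dot\alpha}=\tilde\lambda^I_{1\dot\alpha}\eta^A_{1I}-\tilde\lambda^I_{2\dot\alpha}\eta^A_{2I}$, $\mathcal Q^A_{P\alpha}=\lambda_{P\alpha}\eta^A_P$, $\tilde{\mathcal Q}^A_{P\dot\alpha}=\tilde\lambda_{P\dot\alpha}\eta^A_P$, with $A$ lowered by $\epsilon_{AB}$.
   Formalization: The square of the barred block is taken as ½ H̄_A H̄^A, minus the stated ½ H̄^A H̄_A; with the stated sign the building-block S^(1) (for s≠0) and S^(2) do not equal their Lorentz covariant forms. *)

theory Defs
  imports "HOL-Analysis.Analysis"
begin

section \<open>The complex Grassmann algebra on a finite ordered set of generators\<close>

text \<open>
  An element is given by its coefficients: \<open>coeff F S\<close> is the coefficient of the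
  monomial which is the product of the generators in \<open>S\<close>, taken in increasing order.
\<close>

typedef 'g grassmann = "UNIV :: ('g set \<Rightarrow> complex) set"
  morphisms coeff Grassmann ..

setup_lifting type_definition_grassmann

text \<open>The sign that sorts (increasing monomial of \<open>T\<close>) times (increasing monomial of \<open>U\<close>).\<close>

definition shuffle_sign :: "'g::{finite,linorder} set \<Rightarrow> 'g set \<Rightarrow> complex" where
  "shuffle_sign T U = (- 1) ^ card {(a, b). a \<in> T \<and> b \<in> U \<and> b < a}"

lemma shuffle_sign_Un1:
  assumes "T \<inter> U = {}"
  shows "shuffle_sign (T \<union> U) V = shuffle_sign T V * shuffle_sign U V"
proof -
  have "{(a, b). a \<in> T \<union> U \<and> b \<in> V \<and> b < a} =
        {(a, b). a \<in> T \<and> b \<in> V \<and> b < a} \<union> {(a, b). a \<in> U \<and> b \<in> V \<and> b < a}"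
    by auto
  then have "card {(a, b). a \<in> T \<union> U \<and> b \<in> V \<and> b < a} =
        card {(a, b). a \<in> T \<and> b \<in> V \<and> b < a} + card {(a, b). a \<in> U \<and> b \<in> V \<and> b < a}"
    using assms by (simp only:, subst card_Un_disjoint) auto
  then show ?thesis by (simp add: shuffle_sign_def power_add)
qed

lemma shuffle_sign_Un2:
  assumes "U \<inter> V = {}"
  shows "shuffle_sign T (U \<union> V) = shuffle_sign T U * shuffle_sign T V"
proof -
  have "{(a, b). a \<in> T \<and> b \<in> U \<union> V \<and> b < a} =
        {(a, b). a \<in> T \<and> b \<in> U \<and> b < a} \<union> {(a, b). a \<in> T \<and> b \<in> V \<and> b < a}"
    by auto
  then have "card {(a, b). a \<in> T \<and> b \<in> U \<union> V \<and> b < a} =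
        card {(a, b). a \<in> T \<and> b \<in> U \<and> b < a} + card {(a, b). a \<in> T \<and> b \<in> V \<and> b < a}"
    using assms by (simp only:, subst card_Un_disjoint) auto
  then show ?thesis by (simp add: shuffle_sign_def power_add)
qed

lemma shuffle_sign_empty [simp]: "shuffle_sign {} U = 1" "shuffle_sign T {} = 1"
  by (simp_all add: shuffle_sign_def)

instantiation grassmann :: ("{finite,linorder}") ring_1
begin

lift_definition zero_grassmann :: "'a grassmann" is "\<lambda>S. 0" .

lift_definition one_grassmann :: "'a grassmann" is "\<lambda>S. if S = {} then 1 else 0" .

lift_definition plus_grassmann :: "'a grassmann \<Rightarrow> 'a grassmann \<Rightarrow> 'a grassmann"
  is "\<lambda>F G S. F S + G S" .

lift_definition minus_grassmann :: "'a grassmann \<Rightarrow> 'a grassmann \<Rightarrow> 'a grassmann"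
  is "\<lambda>F G S. F S - G S" .

lift_definition uminus_grassmann :: "'a grassmann \<Rightarrow> 'a grassmann"
  is "\<lambda>F S. - F S" .

lift_definition times_grassmann :: "'a grassmann \<Rightarrow> 'a grassmann \<Rightarrow> 'a grassmann"
  is "\<lambda>F G S. \<Sum>T\<in>Pow S. shuffle_sign T (S - T) * F T * G (S - T)" .

instance
proof
  fix a b c :: "'a grassmann"
  show "a + b + c = a + (b + c)" by transfer (simp add: add.assoc)
  show "a + b = b + a" by transfer (simp add: add.commute)
  show "0 + a = a" by transfer simp
  show "- a + a = 0" by transfer simp
  show "a - b = a + - b" by transfer simp
  show "(0::'a grassmann) \<noteq> 1" by transfer (auto dest: fun_cong[where x = "{}"])
  show "(a + b) * c = a * c + b * c"
    by transfer (simp add: algebra_simps sum.distrib)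
  show "a * (b + c) = a * b + a * c"
    by transfer (simp add: algebra_simps sum.distrib)
  show "1 * a = a"
  proof (transfer, rule ext)
    fix a :: "'a set \<Rightarrow> complex" and S :: "'a set"
    have "(\<Sum>T\<in>Pow S. shuffle_sign T (S - T) * (if T = {} then 1 else 0) * a (S - T)) =
          (\<Sum>T\<in>Pow S. if T = {} then a S else 0)"
      by (intro sum.cong) auto
    also have "\<dots> = a S" by (simp add: sum.delta)
    finally show "(\<Sum>T\<in>Pow S. shuffle_sign T (S - T) * (if T = {} then 1 else 0) * a (S - T)) = a S" .
  qed
  show "a * 1 = a"
  proof (transfer, rule ext)
    fix a :: "'a set \<Rightarrow> complex" and S :: "'a set"
    have "(\<Sum>T\<in>Pow S. shuffle_sign T (S - T) * a T * (if S - T = {} then 1 else 0)) =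
          (\<Sum>T\<in>Pow S. if T = S then a S else 0)"
      by (intro sum.cong) auto
    also have "\<dots> = a S" by (simp add: sum.delta)
    finally show "(\<Sum>T\<in>Pow S. shuffle_sign T (S - T) * a T * (if S - T = {} then 1 else 0)) = a S" .
  qed
  show "a * b * c = a * (b * c)"
  proof (transfer, rule ext)
    fix a b c :: "'a set \<Rightarrow> complex" and S :: "'a set"
    let ?s = "shuffle_sign :: 'a set \<Rightarrow> 'a set \<Rightarrow> complex"
    have "(\<Sum>T\<in>Pow S. ?s T (S - T) * (\<Sum>U\<in>Pow T. ?s U (T - U) * a U * b (T - U)) * c (S - T)) =
        (\<Sum>(T, U)\<in>(SIGMA T:Pow S. Pow T).
           ?s T (S - T) * (?s U (T - U) * a U * b (T - U)) * c (S - T))"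
      by (simp add: sum.Sigma[symmetric] sum_distrib_left sum_distrib_right)
    also have "\<dots> = (\<Sum>(U, V)\<in>(SIGMA U:Pow S. Pow (S - U)).
           ?s U (S - U) * a U * (?s V (S - U - V) * b V * c (S - U - V)))"
    proof (rule sum.reindex_bij_witness[where j = "\<lambda>(T, U). (U, T - U)" and i = "\<lambda>(U, V). (U \<union> V, U)"])
      fix x assume "x \<in> (SIGMA T:Pow S. Pow T)"
      then obtain T U where x: "x = (T, U)" and TU: "U \<subseteq> T" "T \<subseteq> S" by auto
      have 1: "?s T (S - T) = ?s U (S - T) * ?s (T - U) (S - T)"
        using shuffle_sign_Un1[of U "T - U" "S - T"] TU by (simp add: Un_absorb1)
      have "S - U = (T - U) \<union> (S - T)" using TU by auto
      then have 2: "?s U (S - U) = ?s U (T - U) * ?s U (S - T)"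
        using shuffle_sign_Un2[of "T - U" "S - T" U] by auto
      have 3: "S - U - (T - U) = S - T" using TU by auto
      show "(case case x of (T, U) \<Rightarrow> (U, T - U) of
          (U, V) \<Rightarrow> ?s U (S - U) * a U * (?s V (S - U - V) * b V * c (S - U - V))) =
         (case x of (T, U) \<Rightarrow> ?s T (S - T) * (?s U (T - U) * a U * b (T - U)) * c (S - T))"
        by (simp add: x 1 2 3)
    qed auto
    also have "\<dots> = (\<Sum>U\<in>Pow S. ?s U (S - U) * a U *
          (\<Sum>V\<in>Pow (S - U). ?s V (S - U - V) * b V * c (S - U - V)))"
      by (simp add: sum.Sigma[symmetric] sum_distrib_left)
    finally show "(\<Sum>T\<in>Pow S. ?s T (S - T) * (\<Sum>U\<in>Pow T. ?s U (T - U) * a U * b (T - U)) * c (S - T)) =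
      (\<Sum>U\<in>Pow S. ?s U (S - U) * a U *
          (\<Sum>V\<in>Pow (S - U). ?s V (S - U - V) * b V * c (S - U - V)))" .
  qed
qed

end

lift_definition cscale :: "complex \<Rightarrow> 'g grassmann \<Rightarrow> 'g grassmann"  (infixr \<open>*\<^sub>C\<close> 75)
  is "\<lambda>z F S. z * F S" .

lift_definition gen :: "'g \<Rightarrow> 'g grassmann"
  is "\<lambda>g S. if S = {g} then 1 else 0" .

text \<open>The left derivative with respect to the generator \<open>g\<close>.\<close>

lift_definition left_deriv :: "'g::{finite,linorder} \<Rightarrow> 'g grassmann \<Rightarrow> 'g grassmann"
  is "\<lambda>g F S. if g \<in> S then 0 else (- 1) ^ card {h \<in> S. h < g} * F (insert g S)" .

text \<open>Substitution of \<open>\<phi> g\<close> for every generator \<open>g\<close>.\<close>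

definition gsubst ::
  "('g::{finite,linorder} \<Rightarrow> 'g grassmann) \<Rightarrow> 'g grassmann \<Rightarrow> 'g grassmann" where
  "gsubst \<phi> F = (\<Sum>S\<in>UNIV. coeff F S *\<^sub>C prod_list (map \<phi> (sorted_list_of_set S)))"


section \<open>The Grassmann variables of the three-point amplitude\<close>

text \<open>
  All two-valued indices (massive leg, \<open>SU(2)\<close> little group, R-symmetry, spinor) have type \<open>2\<close>,
  with values \<open>1\<close> and \<open>2\<close>.  \<open>Massive i I\<close> and \<open>Massless\<close> are what \<open>\<eta>\<close> carries besides
  its R-index: \<open>Eta (Massive i I) A\<close> is \<open>\<eta>\<^sup>A\<close> with lower indices \<open>i I\<close>, and
  \<open>Eta Massless A\<close> is the variable of the leg \<open>P\<close>.
\<close>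

datatype slot = Massive "2" "2" | Massless
datatype gvar = Eta slot "2"

instance gvar :: finite
proof
  have "(UNIV :: gvar set) \<subseteq> range (\<lambda>(i, I, A). Eta (Massive i I) A) \<union> range (Eta Massless)"
  proof
    fix g :: gvar
    show "g \<in> range (\<lambda>(i, I, A). Eta (Massive i I) A) \<union> range (Eta Massless)"
    proof (cases g)
      case (Eta s A)
      then show ?thesis by (cases s) (auto simp: image_iff)
    qed
  qed
  then show "finite (UNIV :: gvar set)" by (rule finite_subset) simp
qed

fun gvar_rank :: "gvar \<Rightarrow> nat" where
  "gvar_rank (Eta (Massive i I) A) =
     (if i = 1 then 0 else 4) + (if I = 1 then 0 else 2) + (if A = 1 then 0 else 1)"
| "gvar_rank (Eta Massless A) = 8 + (if A = 1 then 0 else 1)"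

lemma gvar_rank_inject: "gvar_rank g = gvar_rank h \<longleftrightarrow> g = h"
proof -
  have two: "a = b" if "a \<noteq> 1" "b \<noteq> 1" for a b :: 2
    using that exhaust_2 by metis
  show ?thesis
    by (cases g rule: gvar_rank.cases; cases h rule: gvar_rank.cases) (auto split: if_splits intro: two)
qed

instantiation gvar :: linorder
begin
definition "g \<le> h \<longleftrightarrow> gvar_rank g \<le> gvar_rank h"
definition "g < h \<longleftrightarrow> gvar_rank g < gvar_rank h"
instance
  by standard (auto simp: less_eq_gvar_def less_gvar_def gvar_rank_inject)
end

type_synonym grass = "gvar grassmann"

definition eta :: "2 \<Rightarrow> 2 \<Rightarrow> 2 \<Rightarrow> grass" where
  "eta i I A = gen (Eta (Massive i I) A)"

definition etaP :: "2 \<Rightarrow> grass" where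
  "etaP A = gen (Eta Massless A)"

definition eps_up :: "2 \<Rightarrow> 2 \<Rightarrow> complex" where
  "eps_up a b = (if a = b then 0 else if a = 1 then 1 else - 1)"

definition eps_dn :: "2 \<Rightarrow> 2 \<Rightarrow> complex" where
  "eps_dn a b = (if a = b then 0 else if a = 1 then - 1 else 1)"

definition leg_sign :: "2 \<Rightarrow> complex" where
  "leg_sign i = (if i = 1 then 1 else - 1)"

definition lowerR :: "(2 \<Rightarrow> grass) \<Rightarrow> 2 \<Rightarrow> grass" where
  "lowerR X A = (\<Sum>B\<in>UNIV. eps_dn A B *\<^sub>C X B)"

definition R_contraction :: "slot \<Rightarrow> slot \<Rightarrow> grass" where
  "R_contraction a b = (\<Sum>A\<in>UNIV. gen (Eta a A) * lowerR (\<lambda>B. gen (Eta b B)) A)"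

text \<open>Polynomials in the Grassmann variables all of whose R-indices are contracted.\<close>

inductive_set R_contracted :: "grass set" where
  "1 \<in> R_contracted"
| "R_contraction a b \<in> R_contracted"
| "F \<in> R_contracted \<Longrightarrow> z *\<^sub>C F \<in> R_contracted"
| "F \<in> R_contracted \<Longrightarrow> G \<in> R_contracted \<Longrightarrow> F + G \<in> R_contracted"
| "F \<in> R_contracted \<Longrightarrow> G \<in> R_contracted \<Longrightarrow> F * G \<in> R_contracted"


section \<open>Kinematics\<close>

text \<open>
  Complex momenta: \<open>lam\<close> and \<open>lamt\<close> are independent.  \<open>lam k i I\<close> is the spinor
  \<open>\<lambda>\<close> of leg \<open>i\<close> with upper little-group index \<open>I\<close> and lower spinor index.
\<close>

record kinematics =
  lam :: "2 \<Rightarrow> 2 \<Rightarrow> complex^2"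
  lamt :: "2 \<Rightarrow> 2 \<Rightarrow> complex^2"
  lamP :: "complex^2"
  lamtP :: "complex^2"

definition ang :: "complex^2 \<Rightarrow> complex^2 \<Rightarrow> complex" where
  "ang l u = (\<Sum>\<alpha>\<in>UNIV. (\<Sum>\<beta>\<in>UNIV. eps_up \<alpha> \<beta> * l $ \<beta>) * u $ \<alpha>)"

definition sqr :: "complex^2 \<Rightarrow> complex^2 \<Rightarrow> complex" where
  "sqr l u = (\<Sum>\<alpha>\<in>UNIV. l $ \<alpha> * (\<Sum>\<beta>\<in>UNIV. eps_up \<alpha> \<beta> * u $ \<beta>))"

definition momentum :: "kinematics \<Rightarrow> 2 \<Rightarrow> 2 \<Rightarrow> 2 \<Rightarrow> complex" where
  "momentum k i \<alpha> \<alpha>' = (\<Sum>I\<in>UNIV. \<Sum>J\<in>UNIV. lam k i I $ \<alpha> * eps_dn I J * lamt k i J $ \<alpha>')"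

text \<open>
  The spinors of the massless leg are nonzero, since otherwise there are no reference spinors
  \<open>\<zeta>\<close>, \<open>\<xi>\<close> and no factor \<open>x\<close>.
\<close>

definition on_shell :: "real \<Rightarrow> kinematics set" where
  "on_shell m = {k.
     (\<forall>i I J. ang (lam k i I) (lam k i J) = - of_real m * eps_up I J) \<and>
     (\<forall>i I J. sqr (lamt k i I) (lamt k i J) = of_real m * eps_up I J) \<and>
     lamP k \<noteq> 0 \<and> lamtP k \<noteq> 0 \<and>
     (\<forall>\<alpha> \<alpha>'. momentum k 1 \<alpha> \<alpha>' + momentum k 2 \<alpha> \<alpha>' + lamP k $ \<alpha> * lamtP k $ \<alpha>' = 0)}"

definition xfac :: "real \<Rightarrow> kinematics \<Rightarrow> complex" where
  "xfac m k = (THE x. \<forall>\<alpha>. x * lamP k $ \<alpha> =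
     1 / of_real m *
       (\<Sum>\<alpha>'\<in>UNIV. momentum k 1 \<alpha> \<alpha>' * (\<Sum>\<beta>\<in>UNIV. eps_up \<alpha>' \<beta> * lamtP k $ \<beta>)))"


section \<open>Little-group transformations\<close>

definition SU2 :: "(complex^2^2) set" where
  "SU2 = {U. U ** (\<chi> I J. cnj (U $ J $ I)) = mat 1 \<and> det U = 1}"

text \<open>An element of \<open>SU(2) \<times> SU(2) \<times> U(1)\<close>: \<open>U i\<close> acts on leg \<open>i\<close>, and \<open>t\<close> on leg \<open>P\<close>.\<close>

definition little_group :: "((2 \<Rightarrow> complex^2^2) \<times> complex) set" where
  "little_group = {(U, t). (\<forall>i. U i \<in> SU2) \<and> norm t = 1}"

fun lg_kin :: "(2 \<Rightarrow> complex^2^2) \<times> complex \<Rightarrow> kinematics \<Rightarrow> kinematics" where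
  "lg_kin (U, t) k =
     \<lparr>lam = (\<lambda>i I. \<Sum>J\<in>UNIV. U i $ I $ J *s lam k i J),
      lamt = (\<lambda>i I. \<Sum>J\<in>UNIV. U i $ I $ J *s lamt k i J),
      lamP = inverse t *s lamP k,
      lamtP = t *s lamtP k\<rparr>"

text \<open>
  The lower little-group index of \<open>\<eta>\<close> transforms with the inverse of \<open>U\<close>, so that
  contractions of \<open>\<lambda>\<close> or \<open>\<lambda>~\<close> with \<open>\<eta>\<close> over that index are invariant.
\<close>

fun lg_eta :: "(2 \<Rightarrow> complex^2^2) \<times> complex \<Rightarrow> gvar \<Rightarrow> grass" where
  "lg_eta (U, t) (Eta (Massive i I) A) = (\<Sum>J\<in>UNIV. cnj (U i $ I $ J) *\<^sub>C eta i J A)"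
| "lg_eta (U, t) (Eta Massless A) = t *\<^sub>C etaP A"

definition lg_invariant :: "real \<Rightarrow> (kinematics \<Rightarrow> grass) \<Rightarrow> bool" where
  "lg_invariant m \<A> \<longleftrightarrow>
     (\<forall>k\<in>on_shell m. \<forall>u\<in>little_group. gsubst (lg_eta u) (\<A> (lg_kin u k)) = \<A> k)"

definition lg_invariant_coeff :: "real \<Rightarrow> (kinematics \<Rightarrow> complex) \<Rightarrow> bool" where
  "lg_invariant_coeff m a \<longleftrightarrow> (\<forall>k\<in>on_shell m. \<forall>u\<in>little_group. a (lg_kin u k) = a k)"


section \<open>Supersymmetry\<close>

text \<open>The derivatives with indices \<open>\<eta>\<^sub>i\<^sup>I\<^sup>A\<close> and \<open>\<eta>\<^sup>I\<^sub>i\<^sub>A\<close>, respectively.\<close>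

definition deriv_upA :: "2 \<Rightarrow> 2 \<Rightarrow> 2 \<Rightarrow> grass \<Rightarrow> grass" where
  "deriv_upA i I A F = - (\<Sum>J\<in>UNIV. eps_dn I J *\<^sub>C left_deriv (Eta (Massive i J) A) F)"

definition deriv_dnA :: "2 \<Rightarrow> 2 \<Rightarrow> 2 \<Rightarrow> grass \<Rightarrow> grass" where
  "deriv_dnA i I A F =
     (\<Sum>J\<in>UNIV. \<Sum>B\<in>UNIV. (eps_dn I J * eps_up A B) *\<^sub>C left_deriv (Eta (Massive i J) B) F)"

definition supercharge :: "real \<Rightarrow> kinematics \<Rightarrow> 2 \<Rightarrow> 2 \<Rightarrow> grass \<Rightarrow> grass" where
  "supercharge \<theta> k A \<alpha> F =
     (\<Sum>i\<in>UNIV. \<Sum>I\<in>UNIV. lam k i I $ \<alpha> *\<^sub>C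
        (of_real (cos \<theta>) *\<^sub>C (eta i I A * F)
         + (of_real (sin \<theta>) * leg_sign i) *\<^sub>C deriv_dnA i I A F))
     + lamP k $ \<alpha> *\<^sub>C (etaP A * F)"

definition supercharge_t :: "real \<Rightarrow> kinematics \<Rightarrow> 2 \<Rightarrow> 2 \<Rightarrow> grass \<Rightarrow> grass" where
  "supercharge_t \<theta> k \<alpha>' A F =
     (\<Sum>i\<in>UNIV. \<Sum>I\<in>UNIV. lamt k i I $ \<alpha>' *\<^sub>C
        (of_real (cos \<theta>) *\<^sub>C deriv_upA i I A F
         - (of_real (sin \<theta>) * leg_sign i) *\<^sub>C (lowerR (eta i I) A * F)))
     + lamtP k $ \<alpha>' *\<^sub>C left_deriv (Eta Massless A) F"

definition susy_invariant :: "real \<Rightarrow> real \<Rightarrow> (kinematics \<Rightarrow> grass) \<Rightarrow> bool" where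
  "susy_invariant m \<theta> \<A> \<longleftrightarrow>
     (\<forall>k\<in>on_shell m. \<forall>A \<alpha>. supercharge \<theta> k A \<alpha> (\<A> k) = 0 \<and> supercharge_t \<theta> k \<alpha> A (\<A> k) = 0)"


section \<open>The two solutions in terms of the building blocks\<close>

definition delta :: "kinematics \<Rightarrow> 2 \<Rightarrow> grass" where
  "delta k A = (\<Sum>i\<in>UNIV. \<Sum>I\<in>UNIV. ang (lamP k) (lam k i I) *\<^sub>C eta i I A)"

definition calH :: "kinematics \<Rightarrow> complex^2 \<Rightarrow> 2 \<Rightarrow> grass" where
  "calH k \<zeta> A = (1 / ang \<zeta> (lamP k)) *\<^sub>C
     (\<Sum>i\<in>UNIV. \<Sum>I\<in>UNIV. ang \<zeta> (lam k i I) *\<^sub>C eta i I A)"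

definition calHbar :: "kinematics \<Rightarrow> complex^2 \<Rightarrow> 2 \<Rightarrow> grass" where
  "calHbar k \<xi> A = (1 / sqr \<xi> (lamtP k)) *\<^sub>C
     (\<Sum>i\<in>UNIV. \<Sum>I\<in>UNIV. (sqr \<xi> (lamt k i I) * leg_sign i) *\<^sub>C eta i I A)"

definition R_dot :: "(2 \<Rightarrow> grass) \<Rightarrow> (2 \<Rightarrow> grass) \<Rightarrow> grass" where
  "R_dot X Y = (1/2) *\<^sub>C (\<Sum>A\<in>UNIV. X A * lowerR Y A)"

text \<open>
  The square of the barred block is taken with the lowered factor on the left; for \<open>X\<close> linear
  in \<open>\<eta>\<close> this is minus \<open>R_dot X X\<close>.  This sign is forced by supersymmetry: at second order in \<open>\<eta>\<^sub>P\<close> the condition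
  for the charges \<open>supercharge_t\<close> makes \<open>h\<close> of the first solution the exponential of
  \<open>- 2 (s/c) R_dot H Hbar\<close>, and
  \<open>2 (R_dot H Hbar)\<^sup>2 = - R_dot H H * R_dot Hbar Hbar\<close>, whereas the quartic term of \<open>h\<close>
  is \<open>+ (s/c)\<^sup>2\<close> times the product of the two squares.  The Lorentz covariant forms below
  require the same sign.
\<close>

definition R_dot_bar :: "(2 \<Rightarrow> grass) \<Rightarrow> grass" where
  "R_dot_bar X = (1/2) *\<^sub>C (\<Sum>A\<in>UNIV. lowerR X A * X A)"

definition assemble ::
  "kinematics \<Rightarrow> complex \<Rightarrow> grass \<Rightarrow> (2 \<Rightarrow> grass) \<Rightarrow> grass \<Rightarrow> grass" where
  "assemble k C f g h = C *\<^sub>C (delta k 1 * delta k 2 *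
     (f + (\<Sum>A\<in>UNIV. etaP A * g A) + (1/2) *\<^sub>C (\<Sum>A\<in>UNIV. etaP A * lowerR etaP A) * h))"

definition S1 :: "real \<Rightarrow> kinematics \<Rightarrow> complex^2 \<Rightarrow> complex^2 \<Rightarrow> grass" where
  "S1 \<theta> k \<zeta> \<xi> =
    (let c = of_real (cos \<theta>); s = of_real (sin \<theta>); H = calH k \<zeta>; Hb = calHbar k \<xi> in
     assemble k (c\<^sup>2)
       ((1 / c\<^sup>2) *\<^sub>C R_dot H H)
       (\<lambda>A. (1 / c) *\<^sub>C lowerR H A + (s / c\<^sup>2) *\<^sub>C (R_dot H H * lowerR Hb A))
       (1 - (2 * s / c) *\<^sub>C R_dot H Hb + (s\<^sup>2 / c\<^sup>2) *\<^sub>C (R_dot H H * R_dot_bar Hb)))"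

definition S2 :: "real \<Rightarrow> real \<Rightarrow> kinematics \<Rightarrow> complex^2 \<Rightarrow> complex^2 \<Rightarrow> grass" where
  "S2 m \<theta> k \<zeta> \<xi> =
    (let c = of_real (cos \<theta>); s = of_real (sin \<theta>); H = calH k \<zeta>; Hb = calHbar k \<xi> in
     assemble k (- xfac m k)
       (s\<^sup>2 *\<^sub>C 1 + (2 * c * s) *\<^sub>C R_dot H Hb + c\<^sup>2 *\<^sub>C (R_dot H H * R_dot_bar Hb))
       (\<lambda>A. c *\<^sub>C (lowerR H A * R_dot_bar Hb) + s *\<^sub>C lowerR Hb A)
       (R_dot_bar Hb))"


section \<open>The two solutions in Lorentz covariant form\<close>

text \<open>Grassmann-valued spinors, and R-vectors of such (R-index first).\<close>

type_synonym gspinor = "2 \<Rightarrow> grass"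

definition gang :: "gspinor \<Rightarrow> gspinor \<Rightarrow> grass" where
  "gang X Y = (\<Sum>\<alpha>\<in>UNIV. (\<Sum>\<beta>\<in>UNIV. eps_up \<alpha> \<beta> *\<^sub>C X \<beta>) * Y \<alpha>)"

definition gsqr :: "gspinor \<Rightarrow> gspinor \<Rightarrow> grass" where
  "gsqr X Y = (\<Sum>\<alpha>\<in>UNIV. X \<alpha> * (\<Sum>\<beta>\<in>UNIV. eps_up \<alpha> \<beta> *\<^sub>C Y \<beta>))"

definition lowerRS :: "(2 \<Rightarrow> gspinor) \<Rightarrow> 2 \<Rightarrow> gspinor" where
  "lowerRS X A = (\<lambda>\<alpha>. lowerR (\<lambda>B. X B \<alpha>) A)"

definition const_spinor :: "complex^2 \<Rightarrow> gspinor" where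
  "const_spinor l = (\<lambda>\<alpha>. l $ \<alpha> *\<^sub>C 1)"

definition calQ :: "kinematics \<Rightarrow> 2 \<Rightarrow> gspinor" where
  "calQ k A = (\<lambda>\<alpha>. \<Sum>i\<in>UNIV. \<Sum>I\<in>UNIV. lam k i I $ \<alpha> *\<^sub>C eta i I A)"

definition calQt :: "kinematics \<Rightarrow> 2 \<Rightarrow> gspinor" where
  "calQt k A = (\<lambda>\<alpha>. \<Sum>i\<in>UNIV. \<Sum>I\<in>UNIV. (leg_sign i * lamt k i I $ \<alpha>) *\<^sub>C eta i I A)"

definition calQP :: "kinematics \<Rightarrow> 2 \<Rightarrow> gspinor" where
  "calQP k A = (\<lambda>\<alpha>. lamP k $ \<alpha> *\<^sub>C etaP A)"

definition calQtP :: "kinematics \<Rightarrow> 2 \<Rightarrow> gspinor" where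
  "calQtP k A = (\<lambda>\<alpha>. lamtP k $ \<alpha> *\<^sub>C etaP A)"

definition lg_dot :: "(2 \<Rightarrow> grass) \<Rightarrow> (2 \<Rightarrow> grass) \<Rightarrow> grass" where
  "lg_dot X Y = (- 1 / 2) *\<^sub>C (\<Sum>I\<in>UNIV. \<Sum>J\<in>UNIV. eps_up I J *\<^sub>C (X I * Y J))"

definition E_up :: "2 \<Rightarrow> 2 \<Rightarrow> grass" where
  "E_up B C = lg_dot (\<lambda>I. eta 1 I B) (\<lambda>I. eta 1 I C) - lg_dot (\<lambda>I. eta 2 I B) (\<lambda>I. eta 2 I C)"

definition E_dn :: "2 \<Rightarrow> 2 \<Rightarrow> grass" where
  "E_dn B C = lg_dot (\<lambda>I. lowerR (eta 1 I) B) (\<lambda>I. lowerR (eta 1 I) C)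
            - lg_dot (\<lambda>I. lowerR (eta 2 I) B) (\<lambda>I. lowerR (eta 2 I) C)"

definition S1_cov :: "real \<Rightarrow> real \<Rightarrow> kinematics \<Rightarrow> grass" where
  "S1_cov m \<theta> k =
    (let c = of_real (cos \<theta>); s = of_real (sin \<theta>); x = xfac m k;
         Q = calQ k; Ql = lowerRS (calQ k);
         Qt = calQt k; Qtl = lowerRS (calQt k);
         QP = calQP k; QPl = lowerRS (calQP k);
         QtP = calQtP k; QtPl = lowerRS (calQtP k)
     in (c\<^sup>2 / 4) *\<^sub>C (\<Sum>A\<in>UNIV. \<Sum>B\<in>UNIV. gang (Q A) (QP B) * gang (Ql A) (QPl B))
      + (c * s / (6 * x)) *\<^sub>C
          ((\<Sum>A\<in>UNIV. \<Sum>B\<in>UNIV. gang (Q A) (Q B) * gsqr (Qtl A) (Qtl B)) * R_dot etaP etaP)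
      + (s\<^sup>2 / (12 * x\<^sup>2)) *\<^sub>C
          ((\<Sum>A\<in>UNIV. \<Sum>B\<in>UNIV. gsqr (Qt A) (QtP B) * gsqr (Qtl A) (QtPl B))
           * (\<Sum>C\<in>UNIV. \<Sum>D\<in>UNIV. E_up C D * E_dn C D))
      + (c / 3) *\<^sub>C (\<Sum>A\<in>UNIV. \<Sum>B\<in>UNIV. gang (Q A) (Q B) * gang (Ql A) (QPl B))
      - (2 * s / (9 * x)) *\<^sub>C
          (\<Sum>A\<in>UNIV. \<Sum>B\<in>UNIV. \<Sum>C\<in>UNIV.
             gang (Q A) (Q B) * gsqr (Qtl A) (QtP C) * E_dn B C)
      + (1 / 12) *\<^sub>C (\<Sum>A\<in>UNIV. \<Sum>B\<in>UNIV. gang (Q A) (Q B) * gang (Ql A) (Ql B)))"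

definition S2_cov :: "real \<Rightarrow> real \<Rightarrow> kinematics \<Rightarrow> grass" where
  "S2_cov m \<theta> k =
    (let c = of_real (cos \<theta>); s = of_real (sin \<theta>); x = xfac m k;
         Q = calQ k; Ql = lowerRS (calQ k);
         Qt = calQt k; Qtl = lowerRS (calQt k);
         QPl = lowerRS (calQP k); QtP = calQtP k;
         P = const_spinor (lamP k); Pt = const_spinor (lamtP k)
     in (1 / (12 * x)) *\<^sub>C
          ((\<Sum>A\<in>UNIV. \<Sum>B\<in>UNIV. gsqr (Qt A) (Qt B) * gsqr (Qtl A) (Qtl B)) * R_dot etaP etaP)
      - (2 * c / (9 * x)) *\<^sub>C
          (\<Sum>A\<in>UNIV. \<Sum>B\<in>UNIV. \<Sum>C\<in>UNIV.
             gsqr (Qt A) (Qt B) * gsqr (Qtl A) (QtP C) * E_dn B C)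
      + (s / 3) *\<^sub>C (\<Sum>A\<in>UNIV. \<Sum>B\<in>UNIV. gsqr (Qt A) (Qt B) * gang (Ql A) (QPl B))
      + (s\<^sup>2 * x / 2) *\<^sub>C (\<Sum>A\<in>UNIV. gang (Q A) P * gang (Ql A) P)
      + (c * s / 6) *\<^sub>C (\<Sum>A\<in>UNIV. \<Sum>B\<in>UNIV. gang (Q A) (Q B) * gsqr (Qtl A) (Qtl B))
      + (c\<^sup>2 / (6 * x)) *\<^sub>C
          ((\<Sum>A\<in>UNIV. gsqr (Qt A) Pt * gsqr (Qtl A) Pt)
           * (\<Sum>B\<in>UNIV. \<Sum>C\<in>UNIV. E_up B C * E_dn B C)))"

end

theory Submission
  imports Defs
begin

text \<open>
  For a fixed R-index the variables of the two massive legs span a four-dimensional space of linear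
  forms with the symplectic form given by \<open>\<sigma>\<^sub>i \<epsilon>\<^sup>I\<^sup>J\<close>.  The forms \<open>\<delta>\<close>, \<open>H\<close>, \<open>Hbar\<close> satisfy
  \<open>omega H Hbar = 1\<close>, with \<open>\<delta>\<close> orthogonal to both, so they extend by a fourth form to a symplectic
  basis, and the derivations in the supercharges are the raised basis forms.  The charges contracted with
  \<open>P\<close> become two equations in \<open>\<delta>\<close> and its derivation of determinant \<open>c\<^sup>2 - s\<^sup>2\<close>, nonzero because
  \<open>|\<theta>| < pi / 4\<close>; they force the factor \<open>\<delta>\<^sup>1 \<delta>\<^sup>2\<close> and the absence of the fourth form.  The charges contracted
  with the reference spinors determine the amplitude from its part of second order in \<open>\<eta>\<^sub>P\<close>, and fix the
  dependence of that part on \<open>H\<close>.  What remains free is a polynomial in the two \<open>Hbar\<close>; contracted R-indices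
  make it even, which leaves its two coefficients of degree 0 and 2.
\<close>

section \<open>Grassmann algebra\<close>

text \<open>The coefficient vectors \<open>ca\<close>, \<open>cb\<close>, \<open>ce\<close> belong
  to \<delta>, H, Hbar. The vector \<open>ca\<close> occurs in both kinds of charge because the
  first momentum maps the dotted spinor of P to a multiple of the undotted one, which rests on the
  equal masses. Momentum conservation makes \<open>cb\<close> and \<open>ce\<close> conjugate, so
  the derivation in one charge sees the form by which the other multiplies. For the part of second
  order in \<eta>_P this gives a first order system in H, solved by an exponential with rate tan
  \<theta>.

  The fourth form \<open>cg\<close> occurs in no charge. It completes the resolution of the
  symplectic form, which serves twice: an element killed by all derivations of a basis is constant,
  and the quadratic forms E can be expanded.

  Both versions of each solution are reduced to one expression without denominators in the three
  forms. The covariant versions contain no reference spinors, so little-group covariance can be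
  computed with the same \<zeta>, \<xi> before and after a transformation. Invariance of the
  coefficients then follows from linear independence of the two solutions at every kinematic
  point.\<close>

lemma grassmann_eqI: "(\<And>S. coeff F S = coeff G S) \<Longrightarrow> F = G"
  by (metis coeff_inject ext)

lemma coeff_simps:
  "coeff (0 :: 'g::{finite,linorder} grassmann) S = 0"
  "coeff (1 :: 'g grassmann) S = (if S = {} then 1 else 0)"
  "coeff (F + G :: 'g grassmann) S = coeff F S + coeff G S"
  "coeff (F - G :: 'g grassmann) S = coeff F S - coeff G S"
  "coeff (- F :: 'g grassmann) S = - coeff F S"
  "coeff (z *\<^sub>C F) S = z * coeff F S"
  "coeff (gen g) S = (if S = {g} then 1 else 0)"
  "coeff (left_deriv g F) S = (if g \<in> S then 0 else (- 1) ^ card {h \<in> S. h < g} * coeff F (insert g S))"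
  by (transfer; simp)+

lemma coeff_times:
  "coeff (F * G :: 'g::{finite,linorder} grassmann) S =
     (\<Sum>T\<in>Pow S. shuffle_sign T (S - T) * coeff F T * coeff G (S - T))"
  by transfer simp

lemma coeff_sum: "coeff (sum f A :: 'g::{finite,linorder} grassmann) S = (\<Sum>x\<in>A. coeff (f x) S)"
  by (induction A rule: infinite_finite_induct) (auto simp: coeff_simps)

lemma cscale_simps:
  fixes F G :: "'g::{finite,linorder} grassmann"
  shows "0 *\<^sub>C F = 0" "z *\<^sub>C (0 :: 'g grassmann) = 0" "1 *\<^sub>C F = F"
    "z *\<^sub>C w *\<^sub>C F = (z * w) *\<^sub>C F"
    "z *\<^sub>C (F + G) = z *\<^sub>C F + z *\<^sub>C G"
    "z *\<^sub>C (F - G) = z *\<^sub>C F - z *\<^sub>C G"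
    "z *\<^sub>C (- F) = (- z) *\<^sub>C F"
    "- (z *\<^sub>C F) = (- z) *\<^sub>C F"
  by (auto intro!: grassmann_eqI simp: coeff_simps algebra_simps)

lemma cscale_minus_1: "(- 1) *\<^sub>C F = - F" for F :: "'g::{finite,linorder} grassmann"
  using cscale_simps(8)[of 1 F] by (simp add: cscale_simps)

lemma cscale_add_left:
  fixes F :: "'g::{finite,linorder} grassmann"
  shows "(z + w) *\<^sub>C F = z *\<^sub>C F + w *\<^sub>C F"
  by (auto intro!: grassmann_eqI simp: coeff_simps algebra_simps)

lemma times_cscale:
  fixes F G :: "'g::{finite,linorder} grassmann"
  shows "(z *\<^sub>C F) * G = z *\<^sub>C (F * G)" "F * (z *\<^sub>C G) = z *\<^sub>C (F * G)"
  by (auto intro!: grassmann_eqI sum.cong simp: coeff_simps coeff_times sum_distrib_left algebra_simps)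

lemma cscale_sum:
  fixes f :: "'a \<Rightarrow> 'g::{finite,linorder} grassmann"
  shows "z *\<^sub>C sum f A = (\<Sum>x\<in>A. z *\<^sub>C f x)"
  by (induction A rule: infinite_finite_induct) (auto simp: cscale_simps)

lemma cscale_cancel:
  fixes F :: "'g::{finite,linorder} grassmann"
  assumes "z *\<^sub>C F = 0" "z \<noteq> 0"
  shows "F = 0"
proof -
  have "F = (1 / z) *\<^sub>C z *\<^sub>C F" using assms(2) by (simp add: cscale_simps)
  then show ?thesis unfolding assms(1) by (simp add: cscale_simps)
qed

section \<open>Signs and Clifford relations of generators and left derivatives\<close>

lemma card_below_remove:
  fixes S :: "'g::{finite,linorder} set"
  assumes "g \<in> S"
  shows "card {x \<in> S. x < h} = card {x \<in> S - {g}. x < h} + (if g < h then 1 else 0)"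
proof -
  have "{x \<in> S. x < h} = (if g < h then insert g {x \<in> S - {g}. x < h} else {x \<in> S - {g}. x < h})"
    using assms by auto
  then show ?thesis by (simp split: if_splits)
qed

lemma card_below_insert:
  fixes S :: "'g::{finite,linorder} set"
  assumes "g \<notin> S"
  shows "card {x \<in> insert g S. x < h} = card {x \<in> S. x < h} + (if g < h then 1 else 0)"
  using card_below_remove[of g "insert g S" h] assms by simp

lemma coeff_gen_times:
  fixes F :: "'g::{finite,linorder} grassmann"
  shows "coeff (gen g * F) S =
    (if g \<in> S then (- 1) ^ card {h \<in> S. h < g} * coeff F (S - {g}) else 0)"
proof -
  have "coeff (gen g * F) S =
      (\<Sum>T\<in>Pow S. if T = {g} then shuffle_sign {g} (S - {g}) * coeff F (S - {g}) else 0)"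
    unfolding coeff_times coeff_simps by (intro sum.cong) auto
  also have "\<dots> = (if g \<in> S then shuffle_sign {g} (S - {g}) * coeff F (S - {g}) else 0)"
    by simp
  finally have *: "coeff (gen g * F) S = \<dots>" .
  have "{(a, b). a \<in> {g} \<and> b \<in> S - {g} \<and> b < a} = Pair g ` {h \<in> S. h < g}"
    by auto
  then have "shuffle_sign {g} (S - {g}) = (- 1) ^ card {h \<in> S. h < g}"
    by (simp add: shuffle_sign_def card_image inj_on_def)
  then show ?thesis using * by simp
qed

text \<open>Of two distinct generators exactly one lies below the other, so reversing their order
  changes exactly one of the two sign exponents. The trailing factor \<open>F\<close> lets the rule
  act inside right-associated products.\<close>

lemma gen_times_gen_times:
  fixes F :: "'g::{finite,linorder} grassmann"
  shows "gen g * (gen h * F) = - (gen h * (gen g * F))"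
proof (cases "g = h")
  case True
  then show ?thesis by (auto intro!: grassmann_eqI simp: coeff_gen_times coeff_simps)
next
  case False
  show ?thesis
  proof (rule grassmann_eqI)
    fix S
    show "coeff (gen g * (gen h * F)) S = coeff (- (gen h * (gen g * F))) S"
    proof (cases "g \<in> S \<and> h \<in> S")
      case True
      then show ?thesis
        using False card_below_remove[of g S h] card_below_remove[of h S g]
        by (cases "g < h") (auto simp: coeff_gen_times coeff_simps insert_commute Diff_insert2[symmetric])
    qed (auto simp: coeff_gen_times coeff_simps)
  qed
qed

text \<open>The mixed Clifford relation. Together with anticommutation of generators and of
  derivatives among themselves it carries all later computations with the charges.\<close>

lemma left_deriv_gen_times:
  fixes F :: "'g::{finite,linorder} grassmann"
  shows "left_deriv g (gen h * F) = (if g = h then F else 0) - gen h * left_deriv g F"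
proof (cases "g = h")
  case True
  show ?thesis
  proof (rule grassmann_eqI)
    fix S
    show "coeff (left_deriv g (gen h * F)) S = coeff ((if g = h then F else 0) - gen h * left_deriv g F) S"
      using True card_below_remove[of g S g] card_below_insert[of g S g]
      by (cases "g \<in> S") (simp_all add: coeff_gen_times coeff_simps insert_absorb)
  qed
next
  case False
  show ?thesis
  proof (rule grassmann_eqI)
    fix S
    show "coeff (left_deriv g (gen h * F)) S = coeff ((if g = h then F else 0) - gen h * left_deriv g F) S"
    proof (cases "g \<notin> S \<and> h \<in> S")
      case True
      then have "insert g S - {h} = insert g (S - {h})" using False by auto
      then show ?thesis
        using True False card_below_remove[of h S g] card_below_insert[of g S h]
        by (cases "g < h") (auto simp: coeff_gen_times coeff_simps)
    qed (use False in \<open>auto simp: coeff_gen_times coeff_simps\<close>)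
  qed
qed

lemma left_deriv_left_deriv:
  fixes F :: "'g::{finite,linorder} grassmann"
  shows "left_deriv g (left_deriv h F) = - left_deriv h (left_deriv g F)"
proof (cases "g = h")
  case True
  then show ?thesis by (auto intro!: grassmann_eqI simp: coeff_simps)
next
  case False
  show ?thesis
  proof (rule grassmann_eqI)
    fix S
    show "coeff (left_deriv g (left_deriv h F)) S = coeff (- left_deriv h (left_deriv g F)) S"
    proof (cases "g \<notin> S \<and> h \<notin> S")
      case True
      then show ?thesis
        using False card_below_insert[of g S h] card_below_insert[of h S g]
        by (cases "g < h") (auto simp: coeff_simps insert_commute)
    qed (use False in \<open>auto simp: coeff_simps\<close>)
  qed
qed

lemma left_deriv_linear:
  fixes F G :: "'g::{finite,linorder} grassmann"
  shows "left_deriv g (F + G) = left_deriv g F + left_deriv g G"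
    "left_deriv g (F - G) = left_deriv g F - left_deriv g G"
    "left_deriv g (- F) = - left_deriv g F"
    "left_deriv g (z *\<^sub>C F) = z *\<^sub>C left_deriv g F"
    "left_deriv g (0 :: 'g grassmann) = 0"
    "left_deriv g (1 :: 'g grassmann) = 0"
  by (auto intro!: grassmann_eqI simp: coeff_simps algebra_simps)

text \<open>A nonempty \<open>S\<close> contains some \<open>g\<close>, and the coefficient at
  \<open>S\<close> is up to sign a coefficient of \<open>left_deriv g F\<close>.\<close>

lemma constant_if_left_derivs_eq_0:
  fixes F :: "'g::{finite,linorder} grassmann"
  assumes "\<And>g. left_deriv g F = 0"
  shows "F = coeff F {} *\<^sub>C 1"
proof (rule grassmann_eqI)
  fix S
  show "coeff F S = coeff (coeff F {} *\<^sub>C 1) S"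
  proof (cases "S = {}")
    case False
    then obtain g where "g \<in> S" by auto
    then have "coeff (left_deriv g F) (S - {g}) = (- 1) ^ card {h \<in> S - {g}. h < g} * coeff F S"
      by (auto simp: coeff_simps insert_absorb)
    then have "coeff F S = 0" using assms[of g] by (simp add: coeff_simps)
    then show ?thesis using False by (simp add: coeff_simps)
  qed (simp add: coeff_simps)
qed

text \<open>The value \<open>True\<close> stands for odd. The condition is on the support, so 0 has
  both parities. Evenness is what the contraction of R-indices contributes to the spanning
  argument.\<close>

definition parity :: "bool \<Rightarrow> 'g::{finite,linorder} grassmann \<Rightarrow> bool" where
  "parity p F \<longleftrightarrow> (\<forall>S. coeff F S \<noteq> 0 \<longrightarrow> odd (card S) = p)"

lemma parity_linear:
  fixes F G :: "'g::{finite,linorder} grassmann"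
  shows "parity p F \<Longrightarrow> parity p G \<Longrightarrow> parity p (F + G)"
    "parity p F \<Longrightarrow> parity p G \<Longrightarrow> parity p (F - G)"
    "parity p F \<Longrightarrow> parity p (z *\<^sub>C F)"
    "parity p (0 :: 'g grassmann)" "parity False (1 :: 'g grassmann)"
proof -
  assume F: "parity p F" and G: "parity p G"
  have "coeff F S \<noteq> 0 \<or> coeff G S \<noteq> 0" if "coeff (F + G) S \<noteq> 0" for S
    using that by (auto simp: coeff_simps)
  then show "parity p (F + G)" using F G unfolding parity_def by blast
  have "coeff F S \<noteq> 0 \<or> coeff G S \<noteq> 0" if "coeff (F - G) S \<noteq> 0" for S
    using that by (auto simp: coeff_simps)
  then show "parity p (F - G)" using F G unfolding parity_def by blast
next
  assume F: "parity p F"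
  have "coeff F S \<noteq> 0" if "coeff (z *\<^sub>C F) S \<noteq> 0" for S
    using that by (auto simp: coeff_simps)
  then show "parity p (z *\<^sub>C F)" using F unfolding parity_def by blast
qed (simp_all add: parity_def coeff_simps)

lemma parity_uminus: "parity p F \<Longrightarrow> parity p (- F)" for F :: "'g::{finite,linorder} grassmann"
  using parity_linear(2)[OF parity_linear(4), of p F] by simp

lemma parity_sum:
  "(\<And>x. x \<in> A \<Longrightarrow> parity p (f x)) \<Longrightarrow> parity p (sum f A)"
  by (induction A rule: infinite_finite_induct) (simp_all add: parity_linear)

lemma parity_gen_times:
  fixes F :: "'g::{finite,linorder} grassmann"
  assumes "parity (\<not> p) F"
  shows "parity p (gen g * F)"
  unfolding parity_def
proof (intro allI impI)
  fix S assume S: "coeff (gen g * F) S \<noteq> 0"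
  then have "g \<in> S" "coeff F (S - {g}) \<noteq> 0" by (auto simp: coeff_gen_times split: if_splits)
  moreover from this have "odd (card (S - {g})) = (\<not> p)" using assms unfolding parity_def by blast
  moreover have "card S = Suc (card (S - {g}))" using \<open>g \<in> S\<close> by (metis card_Suc_Diff1 finite)
  ultimately show "odd (card S) = p" by (metis even_Suc)
qed

lemma parity_left_deriv:
  fixes F :: "'g::{finite,linorder} grassmann"
  assumes "parity (\<not> p) F"
  shows "parity p (left_deriv g F)"
  unfolding parity_def
proof (intro allI impI)
  fix S assume S: "coeff (left_deriv g F) S \<noteq> 0"
  then have "g \<notin> S" "coeff F (insert g S) \<noteq> 0" by (auto simp: coeff_simps split: if_splits)
  moreover from this have "odd (card (insert g S)) = (\<not> p)" using assms unfolding parity_def by blast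
  ultimately show "odd (card S) = p" by simp
qed

lemma parity_times:
  fixes F G :: "'g::{finite,linorder} grassmann"
  assumes "parity False F" "parity False G"
  shows "parity False (F * G)"
  unfolding parity_def
proof (intro allI impI)
  fix S assume "coeff (F * G) S \<noteq> 0"
  then obtain T where T: "T \<subseteq> S" "coeff F T \<noteq> 0" "coeff G (S - T) \<noteq> 0"
    unfolding coeff_times by (auto elim!: sum.not_neutral_contains_not_neutral)
  then have "even (card T)" "even (card (S - T))" using assms unfolding parity_def by blast+
  moreover have "card S = card T + card (S - T)"
    using card_Diff_subset[of T S] card_mono[of S T] T(1) by simp
  ultimately show "odd (card S) = False" by simp
qed

lemma odd_constant_eq_0:
  assumes "parity True (F :: 'g::{finite,linorder} grassmann)"
  shows "coeff F {} = 0"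
  using assms unfolding parity_def by fastforce

section \<open>Linear forms and derivations\<close>

definition lin :: "(2 \<Rightarrow> 2 \<Rightarrow> complex) \<Rightarrow> 2 \<Rightarrow> grass" where
  "lin w A = (\<Sum>i\<in>UNIV. \<Sum>I\<in>UNIV. w i I *\<^sub>C eta i I A)"

definition dlin :: "(2 \<Rightarrow> 2 \<Rightarrow> complex) \<Rightarrow> 2 \<Rightarrow> grass \<Rightarrow> grass" where
  "dlin v A F = (\<Sum>i\<in>UNIV. \<Sum>I\<in>UNIV. v i I *\<^sub>C left_deriv (Eta (Massive i I) A) F)"

definition dP :: "2 \<Rightarrow> grass \<Rightarrow> grass" where
  "dP A = left_deriv (Eta Massless A)"

definition pair :: "(2 \<Rightarrow> 2 \<Rightarrow> complex) \<Rightarrow> (2 \<Rightarrow> 2 \<Rightarrow> complex) \<Rightarrow> complex" where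
  "pair v w = (\<Sum>i\<in>UNIV. \<Sum>I\<in>UNIV. v i I * w i I)"

lemma gen_times_lin_times: "gen g * (lin v B * F) = - (lin v B * (gen g * F))"
  unfolding lin_def eta_def
  by (simp add: sum_distrib_left sum_distrib_right times_cscale mult.assoc
      gen_times_gen_times[of g] cscale_simps sum_negf[symmetric])

lemma lin_times_lin_times: "lin u A * (lin v B * F) = - (lin v B * (lin u A * F))"
proof -
  have "lin u A * (lin v B * F) =
      (\<Sum>i\<in>UNIV. \<Sum>I\<in>UNIV. u i I *\<^sub>C (gen (Eta (Massive i I) A) * (lin v B * F)))"
    unfolding lin_def[of u] eta_def by (simp add: sum_distrib_right times_cscale)
  also have "\<dots> = - (lin v B * (lin u A * F))"
    unfolding lin_def[of u] eta_def gen_times_lin_times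
    by (simp add: sum_distrib_right sum_distrib_left times_cscale cscale_simps sum_negf[symmetric])
  finally show ?thesis .
qed

lemma etaP_times_lin_times: "etaP A * (lin v B * F) = - (lin v B * (etaP A * F))"
  unfolding etaP_def by (rule gen_times_lin_times)

lemma etaP_times_etaP_times: "etaP A * (etaP B * F) = - (etaP B * (etaP A * F))"
  unfolding etaP_def by (rule gen_times_gen_times)

lemma lin_times_lin: "lin u A * lin v B = - (lin v B * lin u A)"
  using lin_times_lin_times[of u A v B 1] by simp

lemma etaP_times_lin: "etaP A * lin v B = - (lin v B * etaP A)"
  using etaP_times_lin_times[of A v B 1] by simp

lemma etaP_times_etaP: "etaP A * etaP B = - (etaP B * etaP A)"
  using etaP_times_etaP_times[of A B 1] by simp

lemma eq_uminus_iff_0: "F = - F \<longleftrightarrow> F = 0" for F :: "'g::{finite,linorder} grassmann"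
proof
  assume "F = - F"
  then have "coeff F S = - coeff F S" for S by (metis coeff_simps(5))
  then show "F = 0" by (intro grassmann_eqI) (simp add: coeff_simps)
qed simp

lemma lin_square: "lin u A * lin u A = 0" "lin u A * (lin u A * F) = 0"
  using lin_times_lin[of u A u A] lin_times_lin_times[of u A u A F] by (simp_all add: eq_uminus_iff_0)

lemma etaP_square: "etaP A * etaP A = 0" "etaP A * (etaP A * F) = 0"
  using etaP_times_etaP[of A A] etaP_times_etaP_times[of A A F] by (simp_all add: eq_uminus_iff_0)

lemma dlin_linear:
  "dlin v A (F + G) = dlin v A F + dlin v A G"
  "dlin v A (F - G) = dlin v A F - dlin v A G"
  "dlin v A (- F) = - dlin v A F"
  "dlin v A (z *\<^sub>C F) = z *\<^sub>C dlin v A F"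
  "dlin v A 0 = 0"
  "dlin v A 1 = 0"
  unfolding dlin_def
  by (simp_all add: left_deriv_linear cscale_simps sum.distrib sum_subtractf sum_negf[symmetric]
      cscale_sum mult.commute)

lemma dP_linear:
  "dP A (F + G) = dP A F + dP A G"
  "dP A (F - G) = dP A F - dP A G"
  "dP A (- F) = - dP A F"
  "dP A (z *\<^sub>C F) = z *\<^sub>C dP A F"
  "dP A 0 = 0"
  "dP A 1 = 0"
  unfolding dP_def by (simp_all add: left_deriv_linear)

lemma left_deriv_massive_lin_times:
  "left_deriv (Eta (Massive i I) A) (lin w B * F) =
     (if A = B then w i I else 0) *\<^sub>C F - lin w B * left_deriv (Eta (Massive i I) A) F"
proof -
  have "left_deriv (Eta (Massive i I) A) (lin w B * F) =
      (\<Sum>j\<in>UNIV. \<Sum>J\<in>UNIV. w j J *\<^sub>C left_deriv (Eta (Massive i I) A) (gen (Eta (Massive j J) B) * F))"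
    unfolding lin_def eta_def sum_2 
    by (simp add: distrib_right times_cscale left_deriv_linear)
  also have "\<dots> = (\<Sum>j\<in>UNIV. \<Sum>J\<in>UNIV. w j J *\<^sub>C (if i = j \<and> I = J \<and> A = B then F else 0))
       - lin w B * left_deriv (Eta (Massive i I) A) F"
    unfolding lin_def eta_def left_deriv_gen_times sum_2
    by (simp add: distrib_right times_cscale cscale_simps algebra_simps)
  also have "(\<Sum>j\<in>UNIV. \<Sum>J\<in>UNIV. w j J *\<^sub>C (if i = j \<and> I = J \<and> A = B then F else 0))
      = (if A = B then w i I else 0) *\<^sub>C F"
    unfolding sum_2 using exhaust_2[of i] exhaust_2[of I] by (auto simp: cscale_simps)
  finally show ?thesis .
qed

lemma left_deriv_massless_lin_times:
  "left_deriv (Eta Massless A) (lin w B * F) = - (lin w B * left_deriv (Eta Massless A) F)"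
  unfolding lin_def eta_def sum_2
  by (simp add: distrib_right times_cscale left_deriv_linear left_deriv_gen_times cscale_simps algebra_simps)

lemma dlin_lin_times:
  "dlin v A (lin w B * F) = (if A = B then pair v w else 0) *\<^sub>C F - lin w B * dlin v A F"
  unfolding dlin_def left_deriv_massive_lin_times pair_def sum_2
  by (cases "A = B") (simp_all add: cscale_simps cscale_add_left times_cscale algebra_simps)

lemma dlin_etaP_times: "dlin v A (etaP B * F) = - (etaP B * dlin v A F)"
  unfolding dlin_def etaP_def sum_2
  by (simp add: left_deriv_gen_times cscale_simps distrib_left times_cscale algebra_simps)

lemma dP_lin_times: "dP A (lin w B * F) = - (lin w B * dP A F)"
  unfolding dP_def by (rule left_deriv_massless_lin_times)

lemma dP_etaP_times: "dP A (etaP B * F) = (if A = B then F else 0) - etaP B * dP A F"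
  unfolding dP_def etaP_def by (simp add: left_deriv_gen_times)

lemma dlin_lin: "dlin v A (lin w B) = (if A = B then pair v w else 0) *\<^sub>C 1"
  using dlin_lin_times[of v A w B 1] by (simp add: dlin_linear)

lemma dlin_etaP: "dlin v A (etaP B) = 0"
  using dlin_etaP_times[of v A B 1] by (simp add: dlin_linear)

lemma dP_lin: "dP A (lin w B) = 0"
  using dP_lin_times[of A w B 1] by (simp add: dP_linear)

lemma dP_etaP: "dP A (etaP B) = (if A = B then 1 else 0)"
  using dP_etaP_times[of A B 1] by (simp add: dP_linear)

lemma left_deriv_dlin: "left_deriv g (dlin v B F) = - dlin v B (left_deriv g F)"
  unfolding dlin_def sum_2 
  by (simp add: left_deriv_linear left_deriv_left_deriv[of g] cscale_simps algebra_simps)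

lemma dlin_dlin: "dlin u A (dlin v B F) = - dlin v B (dlin u A F)"
  unfolding dlin_def[of u] left_deriv_dlin sum_2 by (simp add: dlin_linear cscale_simps algebra_simps)

lemma dlin_dP: "dlin u A (dP B F) = - dP B (dlin u A F)"
  unfolding dP_def left_deriv_dlin by simp

lemma dP_dP: "dP A (dP B F) = - dP B (dP A F)"
  unfolding dP_def by (rule left_deriv_left_deriv)

lemma dlin_square: "dlin u A (dlin u A F) = 0" and dP_square: "dP A (dP A F) = 0"
  using dlin_dlin[of u A u A F] dP_dP[of A A F] by (simp_all add: eq_uminus_iff_0)

lemma parity_lin_times: "parity (\<not> p) F \<Longrightarrow> parity p (lin w A * F)"
  unfolding lin_def eta_def sum_distrib_right times_cscale
  by (intro parity_sum parity_linear parity_gen_times)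

lemma parity_dlin: "parity (\<not> p) F \<Longrightarrow> parity p (dlin w A F)"
  unfolding dlin_def by (intro parity_sum parity_linear parity_left_deriv)

lemma parity_dP: "parity (\<not> p) F \<Longrightarrow> parity p (dP A F)"
  unfolding dP_def by (rule parity_left_deriv)

lemma lin_combination:
  "lin (\<lambda>i I. z * w i I) A = z *\<^sub>C lin w A"
  "lin (\<lambda>i I. u i I + w i I) A = lin u A + lin w A"
  unfolding lin_def sum_2 by (simp_all add: cscale_simps cscale_add_left)

lemma dlin_combination:
  "dlin (\<lambda>i I. z * w i I) A F = z *\<^sub>C dlin w A F"
  "dlin (\<lambda>i I. u i I + w i I) A F = dlin u A F + dlin w A F"
  unfolding dlin_def sum_2 by (simp_all add: cscale_simps cscale_add_left)

section \<open>Substitution is an algebra homomorphism\<close>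

lemma gsubst_linear:
  fixes F G :: "'g::{finite,linorder} grassmann"
  shows "gsubst \<phi> (F + G) = gsubst \<phi> F + gsubst \<phi> G"
    "gsubst \<phi> (F - G) = gsubst \<phi> F - gsubst \<phi> G"
    "gsubst \<phi> (- F) = - gsubst \<phi> F"
    "gsubst \<phi> (z *\<^sub>C F) = z *\<^sub>C gsubst \<phi> F"
    "gsubst \<phi> (0 :: 'g grassmann) = 0"
proof -
  have "(z - w) *\<^sub>C F = z *\<^sub>C F - w *\<^sub>C F" for z w and F :: "'g grassmann"
    by (auto intro!: grassmann_eqI simp: coeff_simps algebra_simps)
  then show "gsubst \<phi> (F + G) = gsubst \<phi> F + gsubst \<phi> G"
    "gsubst \<phi> (F - G) = gsubst \<phi> F - gsubst \<phi> G"
    "gsubst \<phi> (- F) = - gsubst \<phi> F"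
    "gsubst \<phi> (z *\<^sub>C F) = z *\<^sub>C gsubst \<phi> F"
    "gsubst \<phi> (0 :: 'g grassmann) = 0"
    unfolding gsubst_def
    by (simp_all add: coeff_simps cscale_add_left cscale_simps sum.distrib sum_subtractf
        sum_negf[symmetric] cscale_sum)
qed

lemma gsubst_1: "gsubst \<phi> (1 :: 'g::{finite,linorder} grassmann) = 1"
proof -
  have "gsubst \<phi> 1 = (\<Sum>S\<in>UNIV. if S = ({} :: 'g set) then 1 else 0)"
    unfolding gsubst_def by (intro sum.cong) (auto simp: coeff_simps cscale_simps)
  then show ?thesis by simp
qed

definition monom :: "('g::{finite,linorder} \<Rightarrow> 'g grassmann) \<Rightarrow> 'g set \<Rightarrow> 'g grassmann" where
  "monom \<phi> S = prod_list (map \<phi> (sorted_list_of_set S))"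

text \<open>The case \<open>g = h\<close> is included: over the complex numbers it makes squares
  vanish, as multiplicativity of \<open>gsubst\<close> requires.\<close>

definition anticommuting :: "('g \<Rightarrow> 'g::{finite,linorder} grassmann) \<Rightarrow> bool" where
  "anticommuting \<phi> \<longleftrightarrow> (\<forall>g h. \<phi> g * \<phi> h = - (\<phi> h * \<phi> g))"

lemma monom_insert_below:
  assumes "\<And>x. x \<in> S \<Longrightarrow> g < x"
  shows "monom \<phi> (insert g S) = \<phi> g * monom \<phi> S"
proof -
  have "g \<notin> S" using assms by blast
  then have "sorted_list_of_set (insert g S) = insort g (sorted_list_of_set S)"
    by (simp add: sorted_list_of_set.sorted_key_list_of_set_insert_remove)
  also have "\<dots> = g # sorted_list_of_set S"
    using assms by (intro insort_is_Cons) (auto intro: less_imp_le)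
  finally show ?thesis by (simp add: monom_def)
qed

text \<open>The new factor moves right past the factors of smaller index, one sign each, until it
  reaches its place or meets itself. The induction strips off the least factor.\<close>

lemma times_monom:
  assumes "anticommuting \<phi>"
  shows "\<phi> g * monom \<phi> S =
    (if g \<in> S then 0 else (- 1) ^ card {h \<in> S. h < g} *\<^sub>C monom \<phi> (insert g S))"
proof (induction "card S" arbitrary: S)
  case 0
  then have "S = {}" by simp
  then show ?case using monom_insert_below[of "{}" g \<phi>] by (simp add: cscale_simps)
next
  case (Suc n)
  then have "S \<noteq> {}" by auto
  define m where "m = Min S"
  define T where "T = S - {m}"
  have "m \<in> S" unfolding m_def using \<open>S \<noteq> {}\<close> by (intro Min_in) auto
  then have S: "S = insert m T" "m \<notin> T" by (auto simp: T_def)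
  have mT: "m < x" if "x \<in> T" for x
    using that \<open>S \<noteq> {}\<close> Min_le[of S x] by (auto simp: T_def m_def order.strict_iff_order)
  have IH: "\<phi> g * monom \<phi> T =
      (if g \<in> T then 0 else (- 1) ^ card {h \<in> T. h < g} *\<^sub>C monom \<phi> (insert g T))"
    using Suc S by (intro Suc) auto
  have mon: "monom \<phi> S = \<phi> m * monom \<phi> T"
    unfolding S(1) using mT by (rule monom_insert_below)
  have comm: "\<phi> x * \<phi> y = - (\<phi> y * \<phi> x)" for x y
    using assms unfolding anticommuting_def by blast
  have sq: "\<phi> m * (\<phi> m * monom \<phi> T) = 0"
    using comm[of m m] by (simp add: eq_uminus_iff_0 flip: mult.assoc)
  have anti: "\<phi> g * (\<phi> m * monom \<phi> T) = - (\<phi> m * (\<phi> g * monom \<phi> T))"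
    using comm[of g m] by (simp flip: mult.assoc)
  consider "g = m" | "g < m" | "m < g" by (metis linorder_neqE)
  then show ?case
  proof cases
    case 1
    then show ?thesis unfolding mon using sq S(1) by simp
  next
    case 2
    have gS: "g < x" if "x \<in> S" for x using that mT[of x] 2 unfolding S(1) by force
    then have none: "{h \<in> S. h < g} = {}" and "g \<notin> S" by force+
    moreover have "monom \<phi> (insert g S) = \<phi> g * monom \<phi> S" using gS by (rule monom_insert_below)
    ultimately show ?thesis unfolding none by (simp add: cscale_simps)
  next
    case 3
    have ins: "monom \<phi> (insert g S) = \<phi> m * monom \<phi> (insert g T)"
      unfolding S(1) insert_commute[of g m] using mT 3 by (intro monom_insert_below) auto
    have "card {h \<in> S. h < g} = card {h \<in> T. h < g} + 1"
      using card_below_remove[of m S g] 3 \<open>m \<in> S\<close> unfolding T_def[symmetric] by simp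
    moreover have "g \<in> S \<longleftrightarrow> g \<in> T" using 3 unfolding S(1) by blast
    ultimately show ?thesis
      unfolding ins mon anti IH by (simp add: times_cscale cscale_simps)
  qed
qed

lemma gsubst_gen_times:
  assumes "anticommuting \<phi>"
  shows "gsubst \<phi> (gen g * F) = \<phi> g * gsubst \<phi> F"
proof -
  have "gsubst \<phi> (gen g * F) = (\<Sum>S\<in>{S. g \<in> S}. coeff (gen g * F) S *\<^sub>C monom \<phi> S)"
    unfolding gsubst_def monom_def[symmetric]
    by (intro sum.mono_neutral_right) (auto simp: coeff_gen_times cscale_simps)
  also have "\<dots> = (\<Sum>S\<in>{S. g \<notin> S}. coeff F S *\<^sub>C (\<phi> g * monom \<phi> S))"
  proof (rule sum.reindex_bij_witness[of _ "insert g" "\<lambda>S. S - {g}"])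
    fix S assume "S \<in> {S. g \<in> S}"
    then have "g \<in> S" by simp
    then show "coeff F (S - {g}) *\<^sub>C (\<phi> g * monom \<phi> (S - {g})) = coeff (gen g * F) S *\<^sub>C monom \<phi> S"
      using card_below_remove[of g S g]
      by (simp add: times_monom[OF assms] coeff_gen_times cscale_simps insert_absorb mult.commute)
  qed auto
  also have "\<dots> = (\<Sum>S\<in>UNIV. coeff F S *\<^sub>C (\<phi> g * monom \<phi> S))"
    by (intro sum.mono_neutral_left) (auto simp: times_monom[OF assms] cscale_simps)
  also have "\<dots> = \<phi> g * gsubst \<phi> F"
    unfolding gsubst_def monom_def[symmetric] by (simp add: sum_distrib_left times_cscale)
  finally show ?thesis .
qed

text \<open>This is the expansion in the monomial basis; it reduces multiplicativity of
  \<open>gsubst\<close> to products of generators.\<close>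

lemma gsubst_gen_self: "gsubst gen F = F"
proof -
  have anti: "anticommuting gen"
    unfolding anticommuting_def using gen_times_gen_times[where F = 1] by (metis mult.right_neutral)
  have "coeff (monom gen S) T = (if S = T then 1 else 0)" for S T :: "'a set"
  proof (induction "card S" arbitrary: S T)
    case 0
    then show ?case by (auto simp: monom_def coeff_simps)
  next
    case (Suc n)
    then have "S \<noteq> {}" by auto
    define m where "m = Min S"
    have S: "m \<in> S" unfolding m_def using \<open>S \<noteq> {}\<close> by (intro Min_in) auto
    have mS: "m < x" if "x \<in> S - {m}" for x
      using that \<open>S \<noteq> {}\<close> Min_le[of S x] by (auto simp: m_def order.strict_iff_order)
    have IH: "coeff (monom gen (S - {m})) T = (if S - {m} = T then 1 else 0)" for T
      using Suc S by (intro Suc) auto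
    have mon: "monom gen S = gen m * monom gen (S - {m})"
      using monom_insert_below[of "S - {m}" m gen] mS S by (simp add: insert_absorb)
    have below: "{h \<in> S. h < m} = {}" using mS by force
    have eq: "S - {m} = T - {m} \<longleftrightarrow> S = T" if "m \<in> T" using that S by auto
    show ?case
    proof (cases "S = T")
      case True
      have "(- 1 :: complex) ^ card {h \<in> T. h < m} = 1" unfolding below[unfolded True] by simp
      then show ?thesis unfolding mon coeff_gen_times IH using S True by simp
    qed (unfold mon coeff_gen_times IH, use S eq in simp)
  qed
  then have "coeff (gsubst gen F) T = (\<Sum>S\<in>UNIV. if S = T then coeff F T else 0)" for T
    unfolding gsubst_def monom_def[symmetric] coeff_sum coeff_simps by (intro sum.cong) auto
  then show ?thesis by (intro grassmann_eqI) simp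
qed

lemma gsubst_times:
  assumes "anticommuting \<phi>"
  shows "gsubst \<phi> (F * G) = gsubst \<phi> F * gsubst \<phi> G"
proof -
  have *: "gsubst \<phi> (prod_list (map gen xs) * G) = prod_list (map \<phi> xs) * gsubst \<phi> G" for xs
    by (induction xs) (simp_all add: mult.assoc gsubst_gen_times[OF assms])
  have sum: "gsubst \<phi> (sum f A) = (\<Sum>x\<in>A. gsubst \<phi> (f x))" for f :: "'a set \<Rightarrow> 'a grassmann" and A
    by (induction A rule: infinite_finite_induct) (simp_all add: gsubst_linear)
  have "gsubst \<phi> (F * G) = gsubst \<phi> (gsubst gen F * G)" by (simp add: gsubst_gen_self)
  also have "\<dots> = gsubst \<phi> F * gsubst \<phi> G"
    unfolding gsubst_def[of gen] gsubst_def[of \<phi> F]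
    by (simp add: sum_distrib_right times_cscale sum gsubst_linear *)
  finally show ?thesis .
qed

section \<open>Symplectic bases of linear forms\<close>

definition omega :: "(2 \<Rightarrow> 2 \<Rightarrow> complex) \<Rightarrow> (2 \<Rightarrow> 2 \<Rightarrow> complex) \<Rightarrow> complex" where
  "omega u w = (\<Sum>i\<in>UNIV. leg_sign i * (u i 1 * w i 2 - u i 2 * w i 1))"

text \<open>Up to sign the vector dual to \<open>w\<close> under \<open>omega\<close>;
  \<open>dlin (raise w)\<close> is the derivation that accompanies multiplication by
  \<open>lin w\<close> in a supercharge.\<close>

definition raise :: "(2 \<Rightarrow> 2 \<Rightarrow> complex) \<Rightarrow> 2 \<Rightarrow> 2 \<Rightarrow> complex" where
  "raise w i I = leg_sign i * (if I = 1 then w i 2 else - w i 1)"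

definition Omega :: "2 \<Rightarrow> 2 \<Rightarrow> 2 \<Rightarrow> 2 \<Rightarrow> complex" where
  "Omega i I j J = (if i = j then leg_sign i * eps_up I J else 0)"

lemma two_values:
  "eps_up 1 1 = 0" "eps_up 2 2 = 0" "eps_up 1 2 = 1" "eps_up 2 1 = - 1"
  "eps_dn 1 1 = 0" "eps_dn 2 2 = 0" "eps_dn 1 2 = - 1" "eps_dn 2 1 = 1"
  "leg_sign 1 = 1" "leg_sign 2 = - 1"
  by (simp_all add: eps_up_def eps_dn_def leg_sign_def)

lemma pair_raise: "pair (raise u) w = - omega u w"
  unfolding pair_def raise_def omega_def sum_2 by (simp add: algebra_simps)

lemma omega_swap: "omega w u = - omega u w"
  unfolding omega_def sum_2 by (simp add: algebra_simps)

lemma omega_self: "omega w w = 0"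
  unfolding omega_def sum_2 by (simp add: algebra_simps)

lemma sum_2_2: "(\<Sum>p\<in>UNIV. f p) = f (1, 1) + f (1, 2) + f (2, 1) + f (2, 2)"
  for f :: "2 \<times> 2 \<Rightarrow> 'a::comm_monoid_add"
proof -
  have "(\<Sum>p\<in>UNIV. f p) = (\<Sum>i\<in>UNIV. \<Sum>I\<in>UNIV. f (i, I))"
    unfolding UNIV_Times_UNIV[symmetric] sum.cartesian_product by simp
  then show ?thesis by (simp add: sum_2 add.assoc)
qed

locale symplectic_basis =
  fixes a g b e :: "2 \<Rightarrow> 2 \<Rightarrow> complex"
  assumes omega_ag: "omega a g = 1" and omega_be: "omega b e = 1"
    and omega_ab: "omega a b = 0" and omega_ae: "omega a e = 0"
    and omega_gb: "omega g b = 0" and omega_ge: "omega g e = 0"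
begin

lemma pairings:
  "pair (raise a) a = 0" "pair (raise a) g = - 1" "pair (raise a) b = 0" "pair (raise a) e = 0"
  "pair (raise g) a = 1" "pair (raise g) g = 0" "pair (raise g) b = 0" "pair (raise g) e = 0"
  "pair (raise b) a = 0" "pair (raise b) g = 0" "pair (raise b) b = 0" "pair (raise b) e = - 1"
  "pair (raise e) a = 0" "pair (raise e) g = 0" "pair (raise e) b = 1" "pair (raise e) e = 0"
  unfolding pair_raise
  using omega_ag omega_be omega_ab omega_ae omega_gb omega_ge
    omega_swap[of g a] omega_swap[of e b] omega_swap[of b a] omega_swap[of e a]
    omega_swap[of b g] omega_swap[of e g]
  by (simp_all add: omega_self)

text \<open>The matrix with rows \<open>a\<close>, \<open>g\<close>, \<open>e\<close>, \<open>b\<close> is symplectic, hence so is its transpose.\<close>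

lemma resolution_of_Omega:
  "b i I * e j J - e i I * b j J + a i I * g j J - g i I * a j J = Omega i I j J"
proof -
  \<comment> \<open>The order \<open>e\<close>, \<open>b\<close> of the last two rows compensates
    the sign of the second leg in \<open>Omega\<close>.\<close>
  define M :: "complex^(2 \<times> 2)^(2 \<times> 2)" where
    "M = (\<chi> p q. (if fst p = 1 then if snd p = 1 then a else g else if snd p = 1 then e else b)
      (fst q) (snd q))"
  define W :: "complex^(2 \<times> 2)^(2 \<times> 2)" where
    "W = (\<chi> p q. Omega (fst p) (snd p) (fst q) (snd q))"
  have WW: "W ** W = - mat 1"
    unfolding vec_eq_iff W_def
    by (simp add: matrix_matrix_mult_def sum_2_2 Omega_def two_values mat_def forall_2 split_paired_all)
  have MWM: "M ** W ** transpose M = W"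
    unfolding vec_eq_iff W_def M_def
    using omega_ag omega_be omega_ab omega_ae omega_gb omega_ge
    by (simp add: matrix_matrix_mult_def transpose_def sum_2_2 Omega_def two_values forall_2
        split_paired_all omega_def sum_2 algebra_simps)
  have neg: "A ** (- B) = - (A ** B)" "(- A) ** B = - (A ** B)" for A B :: "complex^(2 \<times> 2)^(2 \<times> 2)"
    by (simp_all add: vec_eq_iff matrix_matrix_mult_def sum_negf)
  \<comment> \<open>The right inverse \<open>- (W ** transpose M ** W)\<close> of the square matrix
    \<open>M\<close> is also a left inverse; multiplication by \<open>W\<close> from the left then
    gives the relation for the transpose.\<close>
  have "M ** (- (W ** transpose M ** W)) = - (M ** W ** transpose M ** W)"
    unfolding neg by (simp only: matrix_mul_assoc)
  also have "\<dots> = mat 1" unfolding MWM WW by simp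
  finally have "(- (W ** transpose M ** W)) ** M = mat 1"
    using matrix_left_right_inverse by blast
  then have "W ** ((- (W ** transpose M ** W)) ** M) = W" by simp
  then have "(- (W ** W)) ** transpose M ** W ** M = W"
    unfolding neg by (simp only: matrix_mul_assoc)
  then have "transpose M ** W ** M = W" unfolding WW by simp
  then have "(transpose M ** W ** M) $ (i, I) $ (j, J) = W $ (i, I) $ (j, J)" by simp
  then show ?thesis
    by (simp add: matrix_matrix_mult_def transpose_def sum_2_2 W_def M_def Omega_def two_values
        algebra_simps)
qed

text \<open>\<open>Omega\<close> is orthogonal, so applying it to the resolution expresses every unit vector by
  raised basis forms.\<close>

lemma left_deriv_eq_0:
  assumes "dlin (raise a) A F = 0" "dlin (raise g) A F = 0" "dlin (raise b) A F = 0" "dlin (raise e) A F = 0"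
  shows "left_deriv (Eta (Massive j J) A) F = 0"
proof -
  define u where "u i I = (if i = j \<and> I = J then 1 else 0 :: complex)" for i I
  have "leg_sign i * leg_sign i = 1" for i by (simp add: leg_sign_def)
  then have u: "u i I = b j J * raise e i I + ((- e j J) * raise b i I + (a j J * raise g i I + (- g j J) * raise a i I))"
    for i I
    using resolution_of_Omega[of j J i 1] resolution_of_Omega[of j J i 2] exhaust_2[of i] exhaust_2[of I]
      exhaust_2[of j] exhaust_2[of J]
    by (auto simp: u_def raise_def Omega_def two_values algebra_simps)
  have "left_deriv (Eta (Massive j J) A) F = dlin u A F"
    unfolding dlin_def u_def sum_2 using exhaust_2[of j] exhaust_2[of J] by (auto simp: cscale_simps)
  also have "u = (\<lambda>i I. b j J * raise e i I + ((- e j J) * raise b i I + (a j J * raise g i I + (- g j J) * raise a i I)))"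
    using u by blast
  also have "dlin \<dots> A F = 0"
    unfolding dlin_combination assms by (simp add: cscale_simps)
  finally show ?thesis .
qed

text \<open>A terminating orientation of the anticommutation rules: products become right-associated
  and sorted as \<open>a\<close>, \<open>b\<close>, \<open>e\<close>, \<open>g\<close>,
  \<open>etaP\<close>, with R-index 1 before 2. Identities then reduce to comparing scalar
  coefficients of sorted products.\<close>

lemmas normal_order =
  lin_times_lin[of g _ e] lin_times_lin[of g _ b] lin_times_lin[of g _ a] lin_times_lin[of e _ b]
  lin_times_lin[of e _ a] lin_times_lin[of b _ a] lin_times_lin[of a 2 a 1] lin_times_lin[of b 2 b 1]
  lin_times_lin[of e 2 e 1] lin_times_lin[of g 2 g 1]
  lin_times_lin_times[of g _ e] lin_times_lin_times[of g _ b] lin_times_lin_times[of g _ a]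
  lin_times_lin_times[of e _ b] lin_times_lin_times[of e _ a] lin_times_lin_times[of b _ a]
  lin_times_lin_times[of a 2 a 1] lin_times_lin_times[of b 2 b 1]
  lin_times_lin_times[of e 2 e 1] lin_times_lin_times[of g 2 g 1]
  etaP_times_lin etaP_times_lin_times etaP_times_etaP[of 2 1] etaP_times_etaP_times[of 2 1]
  lin_square etaP_square mult.assoc times_cscale cscale_simps distrib_left distrib_right
  left_diff_distrib right_diff_distrib

lemmas leibniz = dlin_linear dP_linear dlin_lin dlin_lin_times dlin_etaP dlin_etaP_times
  dP_lin dP_lin_times dP_etaP dP_etaP_times pairings

end

section \<open>The supersymmetry equations in a symplectic basis\<close>

text \<open>The block form of the first solution with all contractions written out and the prefactor
  c^2 multiplied through, which clears the denominators. The blocks are arguments so that the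
  expression can be evaluated before and after a little-group transformation.\<close>

definition normal_S1 :: "complex \<Rightarrow> complex \<Rightarrow> (2 \<Rightarrow> grass) \<Rightarrow> (2 \<Rightarrow> grass) \<Rightarrow> (2 \<Rightarrow> grass) \<Rightarrow> grass" where
  "normal_S1 c s D H B = D 1 * D 2 *
     (- (H 1 * H 2)
      + etaP 1 * (- (c *\<^sub>C H 2) + s *\<^sub>C (H 1 * H 2 * B 2))
      + etaP 2 * (c *\<^sub>C H 1 - s *\<^sub>C (H 1 * H 2 * B 1))
      - etaP 1 * etaP 2 * (c\<^sup>2 *\<^sub>C 1 + (c * s) *\<^sub>C (H 1 * B 2 - H 2 * B 1) - s\<^sup>2 *\<^sub>C (H 1 * H 2 * B 1 * B 2)))"

definition normal_S2 :: "complex \<Rightarrow> complex \<Rightarrow> (2 \<Rightarrow> grass) \<Rightarrow> (2 \<Rightarrow> grass) \<Rightarrow> (2 \<Rightarrow> grass) \<Rightarrow> grass" where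
  "normal_S2 c s D H B = D 1 * D 2 *
     (s\<^sup>2 *\<^sub>C 1 - (c * s) *\<^sub>C (H 1 * B 2 - H 2 * B 1) - c\<^sup>2 *\<^sub>C (H 1 * H 2 * B 1 * B 2)
      + etaP 1 * (- (c *\<^sub>C (H 2 * B 1 * B 2)) - s *\<^sub>C B 2)
      + etaP 2 * (c *\<^sub>C (H 1 * B 1 * B 2) + s *\<^sub>C B 1)
      - etaP 1 * etaP 2 * (B 1 * B 2))"

context symplectic_basis
begin

text \<open>In this order: Q contracted with P, the dotted charge contracted with P and divided by
  x, Q contracted with \<zeta> / <\<zeta> P>, and the dotted charge contracted with \<xi> /
  [\<xi> P].\<close>

definition kernel_equations :: "complex \<Rightarrow> complex \<Rightarrow> grass \<Rightarrow> bool" where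
  "kernel_equations c s F \<longleftrightarrow> (\<forall>A.
     c *\<^sub>C (lin a A * F) + s *\<^sub>C (\<Sum>B\<in>UNIV. eps_up A B *\<^sub>C dlin (raise a) B F) = 0 \<and>
     c *\<^sub>C dlin (raise a) A F + s *\<^sub>C (lowerR (lin a) A * F) = 0 \<and>
     c *\<^sub>C (lin b A * F) + s *\<^sub>C (\<Sum>B\<in>UNIV. eps_up A B *\<^sub>C dlin (raise b) B F) + etaP A * F = 0 \<and>
     - (c *\<^sub>C dlin (raise e) A F) - s *\<^sub>C (lowerR (lin e) A * F) + dP A F = 0)"

lemma kernel_equations_normal:
  assumes "c\<^sup>2 + s\<^sup>2 = 1"
  shows "kernel_equations c s (z *\<^sub>C normal_S1 c s (lin a) (lin b) (lin e) +
    w *\<^sub>C normal_S2 c s (lin a) (lin b) (lin e))"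
proof -
  \<comment> \<open>Eliminating every square of \<open>s\<close> gives a normal form of scalars
    modulo \<open>c\<^sup>2 + s\<^sup>2 = 1\<close>.\<close>
  have ss: "s * s = 1 - c * c" using assms by (simp add: power2_eq_square algebra_simps)
  have ssx: "s * (s * y) = y - c * (c * y)" for y
    unfolding mult.assoc[symmetric] ss by (simp add: algebra_simps)
  show ?thesis
    unfolding kernel_equations_def forall_2 sum_2 two_values lowerR_def normal_S1_def normal_S2_def
    by (intro conjI; simp add: normal_order leibniz; rule grassmann_eqI;
        simp add: coeff_simps; simp add: algebra_simps power2_eq_square ss ssx)
qed

text \<open>The parts of second order in \<eta>_P suffice. Multiplying by both components of
  \<open>lin e\<close> leaves only the lowest term, c^2, of the first solution; once
  \<open>z = 0\<close>, the coefficient of the product of both components of \<open>lin a\<close>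
  and of \<open>lin e\<close> is \<open>w\<close>.\<close>

lemma normal_independent:
  assumes "z *\<^sub>C normal_S1 c s (lin a) (lin b) (lin e) + w *\<^sub>C normal_S2 c s (lin a) (lin b) (lin e) = 0"
    and "c \<noteq> 0"
  shows "z = 0" "w = 0"
proof -
  define F where "F = dP 1 (dP 2 (z *\<^sub>C normal_S1 c s (lin a) (lin b) (lin e) +
    w *\<^sub>C normal_S2 c s (lin a) (lin b) (lin e)))"
  let ?top = "\<lambda>F. dlin (raise g) 1 (dlin (raise g) 2 (dlin (raise b) 1 (dlin (raise b) 2 F)))"
  have F0: "F = 0" unfolding F_def assms(1) by (simp add: dP_linear)
  have "?top (lin e 1 * (lin e 2 * F)) = (z * c\<^sup>2) *\<^sub>C 1"
    unfolding F_def normal_S1_def normal_S2_def by (simp add: normal_order leibniz)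
  then have "coeff ((z * c\<^sup>2) *\<^sub>C 1 :: grass) {} = 0"
    unfolding F0 by (metis coeff_simps(1) dlin_linear(5) mult_zero_right)
  then show "z = 0" using assms(2) by (simp add: coeff_simps)
  have "?top F = w *\<^sub>C 1"
    unfolding F_def normal_S1_def normal_S2_def \<open>z = 0\<close> by (simp add: normal_order leibniz)
  then have "coeff (w *\<^sub>C 1 :: grass) {} = 0"
    unfolding F0 by (metis coeff_simps(1) dlin_linear(5))
  then show "w = 0" by (simp add: coeff_simps)
qed

text \<open>The derivations of \<open>raise a\<close>, \<open>raise b\<close>,
  \<open>raise e\<close> detect \<open>g\<close>, \<open>e\<close>, \<open>b\<close> respectively,
  so \<open>F\<close> involves \<open>lin a\<close> alone, and being annihilated by both of its
  components it is a multiple of their product. That product is even, which excludes odd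
  \<open>F\<close>.\<close>

lemma multiple_of_top_form:
  assumes "\<And>A. dlin (raise a) A F = 0" "\<And>A. dlin (raise b) A F = 0" "\<And>A. dlin (raise e) A F = 0"
    and "\<And>A. dP A F = 0" and top: "\<And>A. lin a A * F = 0"
  obtains z where "F = z *\<^sub>C (lin a 1 * lin a 2)" and "parity True F \<Longrightarrow> z = 0"
proof -
  define G where "G = dlin (raise g) 2 (dlin (raise g) 1 F)"
  \<comment> \<open>The derivation of \<open>raise g\<close> takes \<open>lin a A\<close> to 1, so
    applying it to the vanishing product recovers \<open>F\<close>.\<close>
  have red: "F = lin a A * dlin (raise g) A F" for A
    using arg_cong[OF top[of A], of "dlin (raise g) A"] by (simp add: leibniz cscale_simps)
  have "F = lin a 1 * dlin (raise g) 1 (lin a 2 * dlin (raise g) 2 F)"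
    using red[of 1] red[of 2] by simp
  also have "\<dots> = - (lin a 1 * (lin a 2 * dlin (raise g) 1 (dlin (raise g) 2 F)))"
    by (simp add: leibniz cscale_simps)
  also have "\<dots> = lin a 1 * (lin a 2 * G)"
    unfolding G_def dlin_dlin[of "raise g" 1 "raise g" 2] by simp
  finally have FG: "F = lin a 1 * (lin a 2 * G)" .
  have kill: "dlin (raise w) A G = 0" if "\<And>A. dlin (raise w) A F = 0" for w A
    unfolding G_def dlin_dlin[of "raise w" _ "raise g"] that by (simp add: dlin_linear)
  have killP: "dP A G = 0" for A
    unfolding G_def using dlin_dP[of "raise g" _ A] assms(4) by (metis dlin_linear(5) neg_equal_0_iff_equal)
  have killg: "dlin (raise g) A G = 0" for A
    unfolding G_def using exhaust_2[of A] dlin_dlin[of "raise g" 1 "raise g" 2]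
    by (auto simp: dlin_square dlin_linear)
  have "left_deriv (Eta (Massive i I) A) G = 0" for i I A
    by (rule left_deriv_eq_0) (simp_all add: kill killg assms)
  moreover have "left_deriv (Eta Massless A) G = 0" for A
    using killP unfolding dP_def .
  ultimately have "left_deriv x G = 0" for x
    by (cases x rule: gvar_rank.cases) auto
  then have "G = coeff G {} *\<^sub>C 1" by (rule constant_if_left_derivs_eq_0)
  then obtain z where z: "G = z *\<^sub>C 1" and z_eq: "z = coeff G {}" by blast
  show thesis
  proof
    show "F = z *\<^sub>C (lin a 1 * lin a 2)" unfolding FG z by (simp add: times_cscale)
    show "z = 0" if "parity True F"
      unfolding z_eq G_def using that by (intro odd_constant_eq_0 parity_dlin) simp
  qed
qed

lemma kernel_spanned_by_normal:
  assumes F: "kernel_equations c s F" and even: "parity False F"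
    and cs: "c\<^sup>2 + s\<^sup>2 = 1" "c\<^sup>2 \<noteq> s\<^sup>2" "c \<noteq> 0"
  obtains z w where
    "F = z *\<^sub>C normal_S1 c s (lin a) (lin b) (lin e) + w *\<^sub>C normal_S2 c s (lin a) (lin b) (lin e)"
proof -
  \<comment> \<open>The determinant of the system is \<open>c\<^sup>2 - t\<^sup>2\<close>; below,
    \<open>t\<close> is \<open>s\<close> or \<open>- s\<close>.\<close>
  have solve: "X = 0" if "c *\<^sub>C X + t *\<^sub>C Y = 0" "c *\<^sub>C Y + t *\<^sub>C X = 0" "t\<^sup>2 = s\<^sup>2" for X Y :: grass and t
  proof (rule cscale_cancel)
    show "(c\<^sup>2 - t\<^sup>2) *\<^sub>C X = 0"
    proof (rule grassmann_eqI)
      fix S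
      have "c * coeff X S + t * coeff Y S = 0" "c * coeff Y S + t * coeff X S = 0"
        using that(1,2)[THEN arg_cong[where f = "\<lambda>F. coeff F S"]] by (simp_all add: coeff_simps)
      then show "coeff ((c\<^sup>2 - t\<^sup>2) *\<^sub>C X) S = coeff 0 S"
        unfolding coeff_simps by algebra
    qed
  qed (use cs that(3) in simp)
  note expand = lowerR_def sum_2 two_values cscale_simps add_0 add_0_right times_cscale
  note eq1 = F[unfolded kernel_equations_def, rule_format, of 1, unfolded expand]
  note eq2 = F[unfolded kernel_equations_def, rule_format, of 2, unfolded expand]
  \<comment> \<open>The epsilon tensor couples multiplication at one R-index with the derivation at
    the other; the sign of \<open>s\<close> is plus for \<open>lin a 1\<close> and minus for
    \<open>lin a 2\<close>.\<close>
  have "lin a 1 * F = 0" "dlin (raise a) 2 F = 0" "lin a 2 * F = 0" "dlin (raise a) 1 F = 0"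
    using eq1 eq2 solve[of "lin a 1 * F" s "dlin (raise a) 2 F"] solve[of "dlin (raise a) 2 F" s "lin a 1 * F"]
      solve[of "lin a 2 * F" "- s" "dlin (raise a) 1 F"] solve[of "dlin (raise a) 1 F" "- s" "lin a 2 * F"]
    by (simp_all add: add.commute)
  then have top: "lin a A * F = 0" and da: "dlin (raise a) A F = 0" for A
    using exhaust_2[of A] by auto
  define r where "r = s / c"
  have s: "s = c * r" using cs(3) by (simp add: r_def)
  have r_cancel: "X = r *\<^sub>C Y" if "c *\<^sub>C X = s *\<^sub>C Y" for X Y :: grass
    using arg_cong[OF that, of "\<lambda>F. (1 / c) *\<^sub>C F"] cs(3) by (simp add: cscale_simps r_def)

  \<comment> \<open>\<open>N\<close> is the part of \<open>F\<close> of second order in \<open>\<eta>\<^sub>P\<close>; the third equation rebuilds \<open>F\<close> from it.\<close>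
  define G where "G = dP 1 F"
  define N where "N = dP 2 G"
  have move: "X = Y" if "Z = 0" "\<And>S. coeff X S - coeff Y S = coeff Z S" for X Y Z :: grass
    using that by (intro grassmann_eqI) (simp add: coeff_simps)
  have P1: "etaP 1 * F = - (c *\<^sub>C (lin b 1 * F)) - s *\<^sub>C dlin (raise b) 2 F"
    by (rule move[OF eq1[THEN conjunct2, THEN conjunct2, THEN conjunct1]]) (simp add: coeff_simps)
  have P2: "etaP 2 * F = s *\<^sub>C dlin (raise b) 1 F - c *\<^sub>C (lin b 2 * F)"
    by (rule move[OF eq2[THEN conjunct2, THEN conjunct2, THEN conjunct1]]) (simp add: coeff_simps)
  have dP1: "dP 1 F = c *\<^sub>C dlin (raise e) 1 F - s *\<^sub>C (lin e 2 * F)"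
    by (rule move[OF eq1[THEN conjunct2, THEN conjunct2, THEN conjunct2]]) (simp add: coeff_simps)
  have dP2: "dP 2 F = c *\<^sub>C dlin (raise e) 2 F + s *\<^sub>C (lin e 1 * F)"
    by (rule move[OF eq2[THEN conjunct2, THEN conjunct2, THEN conjunct2]]) (simp add: coeff_simps)
  have dP_dlin: "dP A (dlin u B X) = - dlin u B (dP A X)" for A B u X
    using dlin_dP[of u B A X] by simp
  \<comment> \<open>Since \<open>dP 1\<close> takes \<open>etaP 1 * F\<close> to
    \<open>F - etaP 1 * G\<close>, differentiating the third equation solves it for
    \<open>F\<close>.\<close>
  have "F - etaP 1 * G - (c *\<^sub>C (lin b 1 * G) + s *\<^sub>C dlin (raise b) 2 G) = 0"
    using arg_cong[OF P1, of "dP 1"]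
    by (simp add: dP_linear dP_lin_times dP_etaP_times dP_dlin cscale_simps flip: G_def)
  then have F_eq: "F = c *\<^sub>C (lin b 1 * G) + s *\<^sub>C dlin (raise b) 2 G + etaP 1 * G"
    by (rule move) (simp add: coeff_simps)
  from arg_cong[OF P2, of "\<lambda>X. - dP 2 (dP 1 X)"]
  have "G - etaP 2 * N - (c *\<^sub>C (lin b 2 * N) - s *\<^sub>C dlin (raise b) 1 N) = 0"
    by (simp add: dP_linear dP_lin_times dP_etaP_times dP_dlin cscale_simps flip: N_def G_def)
  then have G_eq: "G = c *\<^sub>C (lin b 2 * N) - s *\<^sub>C dlin (raise b) 1 N + etaP 2 * N"
    by (rule move) (simp add: coeff_simps)
  have dPN: "dP A N = 0" for A
    unfolding N_def G_def using exhaust_2[of A] dP_dP[of 1 2] by (auto simp: dP_square dP_linear)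
  have topN: "lin a A * N = 0" for A
    using arg_cong[OF top[of A], of "\<lambda>X. dP 2 (dP 1 X)"] by (simp add: dP_linear dP_lin_times N_def G_def)
  have daN: "dlin (raise a) A N = 0" for A
    using arg_cong[OF da[of A], of "\<lambda>X. dP 2 (dP 1 X)"] by (simp add: dP_linear dP_dlin N_def G_def)
  \<comment> \<open>As \<open>raise e\<close> detects \<open>b\<close>, this and the next relation
    are first order equations for the dependence of \<open>N\<close> on \<open>lin b\<close>. They
    are solved by the exponential of \<open>r\<close> times
    \<open>lin b 1 * lin e 2 - lin b 2 * lin e 1\<close>, with \<open>r\<close> the tangent.\<close>
  have "c *\<^sub>C dlin (raise e) 1 N = s *\<^sub>C (lin e 2 * N)"
    using arg_cong[OF dP1, of "\<lambda>X. dP 2 (dP 1 X)"]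
    by (simp add: dP_linear dP_dlin dP_lin_times dP_square N_def G_def)
  from r_cancel[OF this] have de1N: "dlin (raise e) 1 N = r *\<^sub>C (lin e 2 * N)" .
  have "c *\<^sub>C dlin (raise e) 2 N + s *\<^sub>C (lin e 1 * N) = 0"
    using arg_cong[OF dP2, of "\<lambda>X. dP 2 (dP 1 X)"] dP_dP[of 1 2 F]
    by (simp add: dP_linear dP_dlin dP_lin_times dP_square cscale_simps N_def G_def)
  then have "c *\<^sub>C dlin (raise e) 2 N = s *\<^sub>C (- (lin e 1 * N))"
    by (rule move) (simp add: coeff_simps)
  from r_cancel[OF this] have de2N: "dlin (raise e) 2 N = - (r *\<^sub>C (lin e 1 * N))"
    by (simp add: cscale_simps)

  \<comment> \<open>Removing the two factors of the exponential in \<open>lin b\<close> and \<open>lin e\<close> makes \<open>n\<close> independent of \<open>lin b\<close>.\<close>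
  define N1 where "N1 = N - r *\<^sub>C (lin b 1 * (lin e 2 * N))"
  define n where "n = N1 + r *\<^sub>C (lin b 2 * (lin e 1 * N1))"
  have N_eq: "N = N1 + r *\<^sub>C (lin b 1 * (lin e 2 * N1))"
    unfolding N1_def by (simp add: normal_order)
  have N1_eq: "N1 = n - r *\<^sub>C (lin b 2 * (lin e 1 * n))"
    unfolding n_def by (simp add: normal_order)
  have de1N1: "dlin (raise e) 1 N1 = 0"
    unfolding N1_def by (simp add: leibniz normal_order de1N)
  have de2N1: "dlin (raise e) 2 N1 = - (r *\<^sub>C (lin e 1 * N1))"
    unfolding N1_def
    by (simp add: leibniz normal_order de2N; rule grassmann_eqI; simp add: coeff_simps)
  have "dlin (raise e) 1 n = 0"
    unfolding n_def by (simp add: leibniz normal_order de1N1 de2N1)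
  moreover have "dlin (raise e) 2 n = 0"
    unfolding n_def
    by (simp add: leibniz normal_order de1N1 de2N1; rule grassmann_eqI; simp add: coeff_simps)
  ultimately have den: "dlin (raise e) A n = 0" for A using exhaust_2[of A] by auto
  have topn: "lin a A * n = 0" for A
    unfolding n_def N1_def using topN[of A] lin_times_lin_times[of a A]
    by (simp add: distrib_left right_diff_distrib times_cscale cscale_simps)
  have dan: "dlin (raise a) A n = 0" and dPn: "dP A n = 0" for A
    unfolding n_def N1_def by (simp_all add: leibniz cscale_simps dPN daN)
  have "parity False N"
    unfolding N_def G_def by (intro parity_dP) (simp add: even)
  then have parity_n: "parity False n"
    unfolding n_def N1_def
    by (intro parity_linear parity_lin_times) simp_all
  \<comment> \<open>The derivation of \<open>raise b\<close> takes \<open>lin e A\<close> to -1.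
    Hence \<open>up\<close> extracts the coefficient of \<open>lin e A\<close>, and
    \<open>low\<close> is the part free of it.\<close>
  define low where "low A X = - dlin (raise b) A (lin e A * X)" for A X
  define up where "up A X = - dlin (raise b) A X" for A X
  have split: "X = low A X + lin e A * up A X" for A X
    unfolding low_def up_def by (simp add: leibniz cscale_simps)
  define annihilated where "annihilated X \<longleftrightarrow>
    (\<forall>A. dlin (raise a) A X = 0 \<and> dlin (raise e) A X = 0 \<and> dP A X = 0 \<and> lin a A * X = 0)" for X
  have ann_n: "annihilated n" unfolding annihilated_def using dan den dPn topn by blast
  have lin_dlin: "lin a A * dlin (raise b) B X = - dlin (raise b) B (lin a A * X)" for A B X
    by (simp add: leibniz cscale_simps)
  have ann: "annihilated (low A X)" "annihilated (up A X)" if "annihilated X" for A X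
    using that unfolding annihilated_def low_def up_def
    by (simp_all add: lin_dlin lin_times_lin_times[of a _ e] dlin_dlin[of _ _ "raise b"] dP_dlin leibniz cscale_simps
        right_diff_distrib times_cscale)
  have kill: "dlin (raise b) B (low A X) = 0" "dlin (raise b) B (up A X) = 0"
    if "dlin (raise b) B X = 0 \<or> A = B" for A B X
    using that dlin_dlin[of "raise b" B "raise b" A]
    by (cases "A = B"; simp add: low_def up_def dlin_linear dlin_square dlin_lin_times cscale_simps)+
  have par: "parity p X \<Longrightarrow> parity p (low A X)" "parity (\<not> p) X \<Longrightarrow> parity p (up A X)" for p A X
    unfolding low_def up_def by (intro parity_uminus parity_dlin parity_lin_times; simp)+
  have top_form: "\<exists>z. X = z *\<^sub>C (lin a 1 * lin a 2) \<and> (parity True X \<longrightarrow> z = 0)"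
    if "annihilated X" "\<And>A. dlin (raise b) A X = 0" for X
    using that unfolding annihilated_def by (metis multiple_of_top_form)
  have killed: "dlin (raise b) B (X 2 (Y 1 n)) = 0" if "X = low \<or> X = up" "Y = low \<or> Y = up" for B X Y
    using that exhaust_2[of B] kill(1)[of 1 n 1] kill(2)[of 1 n 1] by (auto intro!: kill)
  obtain z where z: "low 2 (low 1 n) = z *\<^sub>C (lin a 1 * lin a 2)"
    using top_form[of "low 2 (low 1 n)"] killed[of low low] ann ann_n by blast
  obtain w where w: "up 2 (up 1 n) = w *\<^sub>C (lin a 1 * lin a 2)"
    using top_form[of "up 2 (up 1 n)"] killed[of up up] ann ann_n by blast
  \<comment> \<open>Each \<open>up\<close> changes the parity, so the two mixed parts of the even
    \<open>n\<close> are odd, whereas a multiple of the top form is even.\<close>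
  have "parity True (up 2 (low 1 n))" "parity True (low 2 (up 1 n))"
    using parity_n by (simp_all add: par)
  then have odd: "up 2 (low 1 n) = 0" "low 2 (up 1 n) = 0"
    using top_form[of "up 2 (low 1 n)"] top_form[of "low 2 (up 1 n)"] killed[of up low] killed[of low up] ann ann_n
    by (metis cscale_simps(1))+
  \<comment> \<open>Applying \<open>dP 2\<close> after \<open>dP 1\<close> to
    \<open>normal_S1\<close> gives a lowest term \<open>- c\<^sup>2\<close> times the top form, and
    to \<open>normal_S2\<close> gives minus the top form times \<open>lin e 1 * lin e 2\<close>.
    This explains the division and the signs of the final coefficients.\<close>
  define v where "v = z / c\<^sup>2"
  have v: "z = c * (c * v)" using cs(3) by (simp add: v_def power2_eq_square)
  have n_eq: "n = (c * (c * v)) *\<^sub>C (lin a 1 * lin a 2) + w *\<^sub>C (lin a 1 * (lin a 2 * (lin e 1 * lin e 2)))"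
    using split[of n 1] split[of "low 1 n" 2] split[of "up 1 n" 2] unfolding odd z w v
    by (simp add: normal_order)
  have rr: "c * (c * (r * r)) = 1 - c * c"
    using cs(1) unfolding s by (simp add: power2_eq_square algebra_simps)
  have rrx: "c * (c * (r * (r * y))) = y - c * (c * y)" for y
    using arg_cong[OF rr, of "\<lambda>x. x * y"] by (simp add: algebra_simps)
  have "F = (- v) *\<^sub>C normal_S1 c s (lin a) (lin b) (lin e) + (- w) *\<^sub>C normal_S2 c s (lin a) (lin b) (lin e)"
    unfolding F_eq G_eq N_eq N1_eq n_eq normal_S1_def normal_S2_def
    by (simp add: normal_order leibniz; rule grassmann_eqI; simp add: coeff_simps;
        simp add: s algebra_simps power2_eq_square rr rrx)
  then show thesis by (rule that)
qed

end

section \<open>Kinematics\<close>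

lemma ang_eq: "ang l u = l $ 2 * u $ 1 - l $ 1 * u $ 2"
  and sqr_eq: "sqr l u = l $ 1 * u $ 2 - l $ 2 * u $ 1"
  unfolding ang_def sqr_def sum_2 two_values by simp_all

lemma momentum_eq:
  "momentum k i \<alpha> \<beta> = lam k i 2 $ \<alpha> * lamt k i 1 $ \<beta> - lam k i 1 $ \<alpha> * lamt k i 2 $ \<beta>"
  unfolding momentum_def sum_2 two_values by simp

lemma ang_swap: "ang u l = - ang l u"
  unfolding ang_eq by simp

lemma ang_schouten: "ang u l * ang w n - ang u n * ang w l = ang u w * ang l n"
  unfolding ang_eq by algebra

locale three_point =
  fixes m :: real and k :: kinematics
  assumes mass_pos: "m > 0" and on_shell: "k \<in> on_shell m"
begin

lemma ang_legs: "ang (lam k i 1) (lam k i 2) = - of_real m"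
  and sqr_legs: "sqr (lamt k i 1) (lamt k i 2) = of_real m"
  using on_shell by (simp_all add: on_shell_def two_values)

lemma momentum_conservation:
  "momentum k 1 \<alpha> \<beta> + momentum k 2 \<alpha> \<beta> + lamP k $ \<alpha> * lamtP k $ \<beta> = 0"
  using on_shell by (simp add: on_shell_def)

lemma mass_nonzero: "complex_of_real m \<noteq> 0"
  using mass_pos by simp

lemma contracted_momentum_conservation:
  "(ang u (lam k 1 1) * sqr w (lamt k 1 2) - ang u (lam k 1 2) * sqr w (lamt k 1 1)) +
   (ang u (lam k 2 1) * sqr w (lamt k 2 2) - ang u (lam k 2 2) * sqr w (lamt k 2 1)) =
   ang u (lamP k) * sqr w (lamtP k)"
  using momentum_conservation[of 1 1] momentum_conservation[of 1 2]
    momentum_conservation[of 2 1] momentum_conservation[of 2 2]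
  unfolding ang_eq sqr_eq momentum_eq by algebra

text \<open>The mass-shell condition: a momentum is a product of the two spinor matrices with
  epsilon between them, and each spinor determinant is \<open>m\<close>.\<close>

lemma momentum_det:
  "momentum k i 1 1 * momentum k i 2 2 - momentum k i 1 2 * momentum k i 2 1 = (of_real m)\<^sup>2"
  using ang_legs[of i] sqr_legs[of i] unfolding ang_eq sqr_eq momentum_eq by algebra

definition pP :: "2 \<Rightarrow> complex" where
  "pP \<alpha> = momentum k 1 \<alpha> 1 * lamtP k $ 2 - momentum k 1 \<alpha> 2 * lamtP k $ 1"

text \<open>Both masses are equal, so \<open>P\<close> is orthogonal to the first momentum.\<close>

lemma pP_parallel: "lamP k $ 1 * pP 2 = lamP k $ 2 * pP 1"
proof -
  \<comment> \<open>The massless momentum has rank one, so the determinant of its sum with the first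
    momentum differs from that of the first by a linear term only. Equal masses make this term, the
    contraction of \<open>lamP\<close> with \<open>pP\<close>, vanish.\<close>
  have p2: "momentum k 2 \<alpha> \<beta> = - momentum k 1 \<alpha> \<beta> - lamP k $ \<alpha> * lamtP k $ \<beta>" for \<alpha> \<beta>
    using momentum_conservation[of \<alpha> \<beta>] by algebra
  show ?thesis
    using momentum_det[of 1] momentum_det[of 2] unfolding p2 pP_def by algebra
qed

abbreviation x :: complex where "x \<equiv> xfac m k"

text \<open>This resolves the definite description: a solution exists because \<open>pP\<close> is
  parallel to \<open>lamP\<close>, and a nonzero component of \<open>lamP\<close> makes it
  unique.\<close>

lemma xfac: "of_real m * (x * lamP k $ \<alpha>) = pP \<alpha>"
proof -
  let ?P = "\<lambda>x. \<forall>\<alpha>. x * lamP k $ \<alpha> = 1 / of_real m * pP \<alpha>"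
  have xfac: "x = (THE x. ?P x)"
    unfolding xfac_def pP_def sum_2 two_values by simp
  have "lamP k $ 1 \<noteq> 0 \<or> lamP k $ 2 \<noteq> 0"
    using on_shell by (auto simp: on_shell_def vec_eq_iff forall_2)
  then obtain y where y: "?P y"
  proof
    assume "lamP k $ 1 \<noteq> 0"
    then show ?thesis
      using pP_parallel mass_nonzero by (intro that[of "pP 1 / (of_real m * lamP k $ 1)"]) (auto simp: forall_2 field_simps)
  next
    assume "lamP k $ 2 \<noteq> 0"
    then show ?thesis
      using pP_parallel mass_nonzero by (intro that[of "pP 2 / (of_real m * lamP k $ 2)"]) (auto simp: forall_2 field_simps)
  qed
  moreover have "z = y" if "?P z" for z
    using that y \<open>lamP k $ 1 \<noteq> 0 \<or> lamP k $ 2 \<noteq> 0\<close> by (metis mult_right_cancel)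
  ultimately have "?P (THE x. ?P x)" by (rule theI)
  then have "?P x" unfolding xfac .
  then show ?thesis using mass_nonzero by simp
qed

text \<open>The first momentum maps the dotted spinor of \<open>P\<close> to \<open>m x\<close> times the undotted one and the second
  to its negative; contracting with \<open>\<lambda>\<close> of a leg inverts its momentum.\<close>

lemma sqr_P_leg: "sqr (lamtP k) (lamt k i I) = - (x * leg_sign i * ang (lamP k) (lam k i I))"
proof -
  \<comment> \<open>The massless momentum annihilates its own dotted spinor, so the second momentum
    acts on it as minus the first. This is the origin of \<open>leg_sign\<close> here.\<close>
  have pP2: "pP \<alpha> = - (momentum k 2 \<alpha> 1 * lamtP k $ 2 - momentum k 2 \<alpha> 2 * lamtP k $ 1)" for \<alpha>
    using momentum_conservation[of \<alpha> 1] momentum_conservation[of \<alpha> 2] unfolding pP_def by algebra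
  have pP_leg: "pP \<alpha> = leg_sign i * (momentum k i \<alpha> 1 * lamtP k $ 2 - momentum k i \<alpha> 2 * lamtP k $ 1)" for \<alpha>
    using exhaust_2[of i] pP2[of \<alpha>] by (auto simp: two_values pP_def)
  have m: "of_real m = lam k i 1 $ 1 * lam k i 2 $ 2 - lam k i 1 $ 2 * lam k i 2 $ 1"
    using ang_legs[of i] unfolding ang_eq by (simp add: algebra_simps minus_equation_iff)
  have "momentum k i 2 \<beta> * lam k i 1 $ 1 - momentum k i 1 \<beta> * lam k i 1 $ 2 = of_real m * lamt k i 1 $ \<beta>"
    "momentum k i 2 \<beta> * lam k i 2 $ 1 - momentum k i 1 \<beta> * lam k i 2 $ 2 = of_real m * lamt k i 2 $ \<beta>" for \<beta>
    unfolding m momentum_eq by (simp_all add: algebra_simps)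
  then have invert: "momentum k i 2 \<beta> * lam k i I $ 1 - momentum k i 1 \<beta> * lam k i I $ 2 = of_real m * lamt k i I $ \<beta>" for \<beta>
    using exhaust_2[of I] by auto
  have "of_real m * (x * ang (lamP k) (lam k i I)) =
      of_real m * (x * lamP k $ 2) * lam k i I $ 1 - of_real m * (x * lamP k $ 1) * lam k i I $ 2"
    unfolding ang_eq by (simp add: algebra_simps)
  also have "\<dots> = leg_sign i *
      ((momentum k i 2 1 * lam k i I $ 1 - momentum k i 1 1 * lam k i I $ 2) * lamtP k $ 2 -
       (momentum k i 2 2 * lam k i I $ 1 - momentum k i 1 2 * lam k i I $ 2) * lamtP k $ 1)"
    unfolding xfac pP_leg by (simp add: algebra_simps)
  also have "\<dots> = of_real m * (- (leg_sign i * sqr (lamtP k) (lamt k i I)))"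
    unfolding invert sqr_eq by (simp add: algebra_simps)
  finally have "x * ang (lamP k) (lam k i I) = - (leg_sign i * sqr (lamtP k) (lamt k i I))"
    using mass_nonzero by (metis mult_cancel_left)
  then have "leg_sign i * leg_sign i * sqr (lamtP k) (lamt k i I) = - (x * leg_sign i * ang (lamP k) (lam k i I))"
    by (simp add: algebra_simps)
  moreover have "leg_sign i * leg_sign i = 1" by (simp add: leg_sign_def)
  ultimately show ?thesis by simp
qed

text \<open>Otherwise \<open>lamtP\<close> would be orthogonal to the two independent dotted spinors
  of the first leg.\<close>

lemma xfac_nonzero: "x \<noteq> 0"
proof
  assume "x = 0"
  then have "sqr (lamtP k) (lamt k 1 1) = 0" "sqr (lamtP k) (lamt k 1 2) = 0"
    by (simp_all add: sqr_P_leg)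
  then have "of_real m * lamtP k $ 1 = 0" "of_real m * lamtP k $ 2 = 0"
    using sqr_legs[of 1] unfolding sqr_eq by algebra+
  then have "lamtP k = 0" using mass_nonzero by (simp add: vec_eq_iff forall_2)
  then show False using on_shell by (simp add: on_shell_def)
qed

definition ca :: "2 \<Rightarrow> 2 \<Rightarrow> complex" where
  "ca i I = ang (lamP k) (lam k i I)"

end

locale three_point_reference = three_point +
  fixes \<zeta> \<xi> :: "complex^2"
  assumes zeta: "ang \<zeta> (lamP k) \<noteq> 0" and xi: "sqr \<xi> (lamtP k) \<noteq> 0"
begin

definition cb :: "2 \<Rightarrow> 2 \<Rightarrow> complex" where
  "cb i I = ang \<zeta> (lam k i I) / ang \<zeta> (lamP k)"

definition ce :: "2 \<Rightarrow> 2 \<Rightarrow> complex" where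
  "ce i I = leg_sign i * sqr \<xi> (lamt k i I) / sqr \<xi> (lamtP k)"

text \<open>The first leg's part of \<open>cb\<close>, scaled to pair to 1 with \<open>ca\<close>, corrected by a multiple of \<open>cb\<close> to be
  orthogonal to \<open>ce\<close>.\<close>

definition cg :: "2 \<Rightarrow> 2 \<Rightarrow> complex" where
  "cg i I = (if i = 1 then cb i I / of_real m else 0) - (cb 1 1 * ce 1 2 - cb 1 2 * ce 1 1) / of_real m * cb i I"

lemma delta_eq: "delta k = lin ca" and calH_eq: "calH k \<zeta> = lin cb" and calHbar_eq: "calHbar k \<xi> = lin ce"
  unfolding fun_eq_iff delta_def calH_def calHbar_def lin_def ca_def cb_def ce_def sum_2
  by (simp_all add: cscale_simps mult.commute)

text \<open>By the Schouten identity each leg contributes the same multiple of \<open>m\<close>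
  times its sign; the masses being equal, the two contributions cancel.\<close>

lemma omega_ang:
  "omega (\<lambda>i I. ang u (lam k i I)) (\<lambda>i I. ang w (lam k i I)) = 0"
  unfolding omega_def sum_2 two_values ang_schouten ang_legs by simp

lemma omega_scale: "omega u (\<lambda>i I. w i I / z) = omega u w / z" "omega (\<lambda>i I. u i I / z) w = omega u w / z"
  unfolding omega_def sum_2 by (simp_all add: algebra_simps add_divide_distrib diff_divide_distrib)

text \<open>The sign in the dotted form cancels the one in \<open>omega\<close>, and the sum over
  the legs becomes contracted momentum conservation. It pairs \<open>cb\<close> with
  \<open>ce\<close> to 1, and \<open>ca\<close> with \<open>ce\<close> to 0 because <P P>
  vanishes.\<close>

lemma omega_ang_sqr:
  "omega (\<lambda>i I. ang u (lam k i I)) (\<lambda>i I. leg_sign i * sqr w (lamt k i I)) = ang u (lamP k) * sqr w (lamtP k)"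
  using contracted_momentum_conservation[of u w]
  unfolding omega_def sum_2 two_values by (simp add: algebra_simps)

sublocale symplectic_basis ca cg cb ce
proof
  have self: "ang u u = 0" for u by (simp add: ang_eq)
  show ab: "omega ca cb = 0" and "omega ca ce = 0" and be: "omega cb ce = 1"
    using zeta xi unfolding ca_def cb_def ce_def omega_scale omega_ang omega_ang_sqr by (simp_all add: self)
  let ?\<rho> = "(cb 1 1 * ce 1 2 - cb 1 2 * ce 1 1) / of_real m"
  let ?l = "\<lambda>i I. if i = 1 then cb i I / of_real m else 0"
  have bil: "omega (\<lambda>i I. u i I - z * v i I) w = omega u w - z * omega v w"
    "omega w (\<lambda>i I. u i I - z * v i I) = omega w u - z * omega w v" for u v w z
    unfolding omega_def sum_2 by (simp_all add: algebra_simps)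
  have cg: "cg = (\<lambda>i I. ?l i I - ?\<rho> * cb i I)" unfolding cg_def by simp
  \<comment> \<open>Here only the first leg contributes, so the Schouten identity gives a nonzero
    value.\<close>
  have "omega ca ?l =
      (ang (lamP k) (lam k 1 1) * ang \<zeta> (lam k 1 2) - ang (lamP k) (lam k 1 2) * ang \<zeta> (lam k 1 1)) /
      (ang \<zeta> (lamP k) * of_real m)"
    unfolding omega_def sum_2 two_values ca_def cb_def
    by (simp add: algebra_simps add_divide_distrib diff_divide_distrib)
  also have "\<dots> = 1"
    unfolding ang_schouten ang_legs using zeta mass_nonzero ang_swap[of "lamP k" \<zeta>] by simp
  finally show "omega ca cg = 1" unfolding cg bil ab by simp
  have "omega ?l cb = 0" unfolding omega_def sum_2 two_values by (simp add: field_simps)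
  then show "omega cg cb = 0" unfolding cg bil omega_self by simp
  have "omega ?l ce = ?\<rho>" unfolding omega_def sum_2 two_values using mass_nonzero by (simp add: field_simps)
  then show "omega cg ce = 0" unfolding cg bil be by simp
qed

end

section \<open>The supercharges in the symplectic basis\<close>

lemma raise_scale: "raise (\<lambda>i I. z * w i I) = (\<lambda>i I. z * raise w i I)"
  unfolding raise_def by (auto simp: fun_eq_iff)

lemma lowerR_lin_scale: "lowerR (lin (\<lambda>i I. z * w i I)) A = z *\<^sub>C lowerR (lin w) A"
  unfolding lowerR_def lin_combination sum_2 by (simp add: cscale_simps mult.commute)

text \<open>Contraction with one spinor leaves a single linear form in the charge, which multiplies
  and, raised, differentiates.\<close>

lemma ang_supercharge:
  "u $ 2 *\<^sub>C supercharge \<theta> k A 1 F - u $ 1 *\<^sub>C supercharge \<theta> k A 2 F =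
    of_real (cos \<theta>) *\<^sub>C (lin (\<lambda>i I. ang u (lam k i I)) A * F)
    + of_real (sin \<theta>) *\<^sub>C (\<Sum>B\<in>UNIV. eps_up A B *\<^sub>C dlin (raise (\<lambda>i I. ang u (lam k i I))) B F)
    + ang u (lamP k) *\<^sub>C (etaP A * F)"
  unfolding supercharge_def lin_def dlin_def raise_def deriv_dnA_def sum_2 two_values
  by (rule grassmann_eqI)
    (simp add: distrib_right times_cscale coeff_simps ang_eq algebra_simps two_values)

lemma sqr_supercharge_t:
  "u $ 1 *\<^sub>C supercharge_t \<theta> k 2 A F - u $ 2 *\<^sub>C supercharge_t \<theta> k 1 A F =
    - (of_real (cos \<theta>) *\<^sub>C dlin (raise (\<lambda>i I. leg_sign i * sqr u (lamt k i I))) A F)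
    - of_real (sin \<theta>) *\<^sub>C (lowerR (lin (\<lambda>i I. leg_sign i * sqr u (lamt k i I))) A * F)
    + sqr u (lamtP k) *\<^sub>C dP A F"
  unfolding supercharge_t_def lin_def dlin_def dP_def raise_def deriv_upA_def lowerR_def sum_2 two_values
  by (rule grassmann_eqI)
    (simp add: distrib_right times_cscale coeff_simps sqr_eq algebra_simps two_values)

lemma solve_2_by_2:
  fixes X Y :: grass
  assumes "a * d - b * c \<noteq> 0"
  shows "X = 0 \<and> Y = 0 \<longleftrightarrow> a *\<^sub>C X - b *\<^sub>C Y = 0 \<and> c *\<^sub>C X - d *\<^sub>C Y = 0"
proof (intro iffI conjI)
  assume *: "a *\<^sub>C X - b *\<^sub>C Y = 0 \<and> c *\<^sub>C X - d *\<^sub>C Y = 0"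
  have eq: "a * coeff X S = b * coeff Y S" "c * coeff X S = d * coeff Y S" for S
    using *[THEN conjunct1, THEN arg_cong[where f = "\<lambda>F. coeff F S"]]
      *[THEN conjunct2, THEN arg_cong[where f = "\<lambda>F. coeff F S"]] by (simp_all add: coeff_simps)
  have "(a * d - b * c) * coeff X S = 0" "(a * d - b * c) * coeff Y S = 0" for S
    using eq[of S] by algebra+
  then show "X = 0" "Y = 0" using assms by (auto intro!: grassmann_eqI simp: coeff_simps)
qed (auto simp: cscale_simps)

context three_point_reference
begin

text \<open>The reference spinors are linearly independent of the spinors of P, so contracting with
  both is equivalent to taking the two components; the factor x in the second equation is
  invertible.\<close>

lemma susy_iff_kernel_equations:
  "(\<forall>A \<alpha>. supercharge \<theta> k A \<alpha> F = 0 \<and> supercharge_t \<theta> k \<alpha> A F = 0) \<longleftrightarrow>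
    kernel_equations (of_real (cos \<theta>)) (of_real (sin \<theta>)) F"
proof -
  let ?c = "complex_of_real (cos \<theta>)" and ?s = "complex_of_real (sin \<theta>)"
  have cb: "cb = (\<lambda>i I. 1 / ang \<zeta> (lamP k) * ang \<zeta> (lam k i I))"
    and ce: "ce = (\<lambda>i I. 1 / sqr \<xi> (lamtP k) * (leg_sign i * sqr \<xi> (lamt k i I)))"
    by (simp_all add: fun_eq_iff cb_def ce_def)
  have P: "lamP k $ 2 *\<^sub>C supercharge \<theta> k A 1 F - lamP k $ 1 *\<^sub>C supercharge \<theta> k A 2 F =
      ?c *\<^sub>C (lin ca A * F) + ?s *\<^sub>C (\<Sum>B\<in>UNIV. eps_up A B *\<^sub>C dlin (raise ca) B F)" for A
    unfolding ang_supercharge ca_def[abs_def] by (simp add: ang_eq[of "lamP k" "lamP k"] cscale_simps)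
  have Z: "?c *\<^sub>C (lin cb A * F) + ?s *\<^sub>C (\<Sum>B\<in>UNIV. eps_up A B *\<^sub>C dlin (raise cb) B F) + etaP A * F =
      (1 / ang \<zeta> (lamP k)) *\<^sub>C (\<zeta> $ 2 *\<^sub>C supercharge \<theta> k A 1 F - \<zeta> $ 1 *\<^sub>C supercharge \<theta> k A 2 F)" for A
    unfolding ang_supercharge cb raise_scale lin_combination dlin_combination sum_2 using zeta
    by (simp add: cscale_simps times_cscale mult_ac)
  \<comment> \<open>Both charges contracted with P thus involve the same form \<open>ca\<close>,
    which closes the system for \<delta> and its derivation.\<close>
  have leg_a: "(\<lambda>i I. leg_sign i * sqr (lamtP k) (lamt k i I)) = (\<lambda>i I. (- x) * ca i I)"
    unfolding fun_eq_iff sqr_P_leg ca_def by (simp add: forall_2 two_values)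
  have Pt: "lamtP k $ 1 *\<^sub>C supercharge_t \<theta> k 2 A F - lamtP k $ 2 *\<^sub>C supercharge_t \<theta> k 1 A F =
      x *\<^sub>C (?c *\<^sub>C dlin (raise ca) A F + ?s *\<^sub>C (lowerR (lin ca) A * F))" for A
    unfolding sqr_supercharge_t leg_a raise_scale lowerR_lin_scale dlin_combination
    by (simp add: sqr_eq[of "lamtP k" "lamtP k"] cscale_simps times_cscale mult_ac)
  have X: "- (?c *\<^sub>C dlin (raise ce) A F) - ?s *\<^sub>C (lowerR (lin ce) A * F) + dP A F =
      (1 / sqr \<xi> (lamtP k)) *\<^sub>C (\<xi> $ 1 *\<^sub>C supercharge_t \<theta> k 2 A F - \<xi> $ 2 *\<^sub>C supercharge_t \<theta> k 1 A F)" for A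
    unfolding sqr_supercharge_t ce raise_scale lowerR_lin_scale dlin_combination using xi
    by (simp add: cscale_simps times_cscale mult_ac)
  have scale: "z *\<^sub>C Y = 0 \<longleftrightarrow> Y = 0" if "z \<noteq> 0" for z and Y :: grass
    using cscale_cancel[of z Y] that by (auto simp: cscale_simps)
  have nonzero: "1 / ang \<zeta> (lamP k) \<noteq> 0" "1 / sqr \<xi> (lamtP k) \<noteq> 0" using zeta xi by simp_all
  have Q: "supercharge \<theta> k A 1 F = 0 \<and> supercharge \<theta> k A 2 F = 0 \<longleftrightarrow>
      ?c *\<^sub>C (lin ca A * F) + ?s *\<^sub>C (\<Sum>B\<in>UNIV. eps_up A B *\<^sub>C dlin (raise ca) B F) = 0 \<and>
      ?c *\<^sub>C (lin cb A * F) + ?s *\<^sub>C (\<Sum>B\<in>UNIV. eps_up A B *\<^sub>C dlin (raise cb) B F) + etaP A * F = 0" for A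
    unfolding P[symmetric] Z scale[OF nonzero(1)] by (rule solve_2_by_2) (use zeta in \<open>simp add: ang_eq mult.commute\<close>)
  have Qt: "supercharge_t \<theta> k 2 A F = 0 \<and> supercharge_t \<theta> k 1 A F = 0 \<longleftrightarrow>
      ?c *\<^sub>C dlin (raise ca) A F + ?s *\<^sub>C (lowerR (lin ca) A * F) = 0 \<and>
      - (?c *\<^sub>C dlin (raise ce) A F) - ?s *\<^sub>C (lowerR (lin ce) A * F) + dP A F = 0" for A
    unfolding scale[OF xfac_nonzero, symmetric, of "?c *\<^sub>C dlin (raise ca) A F + ?s *\<^sub>C (lowerR (lin ca) A * F)"]
      Pt[symmetric] X scale[OF nonzero(2)] by (rule solve_2_by_2) (use xi in \<open>simp add: sqr_eq mult.commute\<close>)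
  have "(\<forall>A \<alpha>. supercharge \<theta> k A \<alpha> F = 0 \<and> supercharge_t \<theta> k \<alpha> A F = 0) \<longleftrightarrow>
    (\<forall>A. (supercharge \<theta> k A 1 F = 0 \<and> supercharge \<theta> k A 2 F = 0) \<and>
      (supercharge_t \<theta> k 2 A F = 0 \<and> supercharge_t \<theta> k 1 A F = 0))"
    unfolding forall_2 by blast
  then show ?thesis
    unfolding kernel_equations_def Q Qt by blast
qed

end

section \<open>The two solutions in normal form\<close>

lemma gang_eq: "gang X Y = X 2 * Y 1 - X 1 * Y 2"
  and gsqr_eq: "gsqr X Y = X 1 * Y 2 - X 2 * Y 1"
  unfolding gang_def gsqr_def sum_2 two_values by (simp_all add: cscale_simps cscale_minus_1)

lemma lowerR_eq: "lowerR X 1 = - X 2" "lowerR X 2 = X 1"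
  unfolding lowerR_def sum_2 two_values
  by (simp_all add: cscale_simps cscale_minus_1)

lemma lowerRS_eq: "lowerRS X 1 = (\<lambda>\<alpha>. - X 2 \<alpha>)" "lowerRS X 2 = X 1"
  unfolding lowerRS_def lowerR_eq by simp_all

lemma gang_uminus: "gang (\<lambda>\<alpha>. - X \<alpha>) Y = - gang X Y" "gang X (\<lambda>\<alpha>. - Y \<alpha>) = - gang X Y"
  and gsqr_uminus: "gsqr (\<lambda>\<alpha>. - X \<alpha>) Y = - gsqr X Y" "gsqr X (\<lambda>\<alpha>. - Y \<alpha>) = - gsqr X Y"
  unfolding gang_eq gsqr_eq by simp_all

lemma E_dn_eq: "E_dn 1 1 = E_up 2 2" "E_dn 1 2 = - E_up 2 1" "E_dn 2 1 = - E_up 1 2" "E_dn 2 2 = E_up 1 1"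
  unfolding E_dn_def E_up_def lg_dot_def lowerR_eq sum_2 two_values
  by (rule grassmann_eqI; simp add: cscale_simps coeff_simps algebra_simps)+

context three_point_reference
begin

text \<open>The undotted spinor of each leg is expanded in the basis \<open>lamP\<close>,
  \<zeta>.\<close>

lemma calQ_eq: "calQ k A \<alpha> = lamP k $ \<alpha> *\<^sub>C lin cb A - (\<zeta> $ \<alpha> / ang \<zeta> (lamP k)) *\<^sub>C lin ca A"
proof -
  have "lam k i I $ \<alpha> = lamP k $ \<alpha> * cb i I + (- (\<zeta> $ \<alpha> / ang \<zeta> (lamP k))) * ca i I" for i I
  proof -
    have "lam k i I $ \<alpha> * ang \<zeta> (lamP k) = lamP k $ \<alpha> * ang \<zeta> (lam k i I) - \<zeta> $ \<alpha> * ang (lamP k) (lam k i I)"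
      using exhaust_2[of \<alpha>] unfolding ang_eq by (auto simp: algebra_simps)
    then show ?thesis
      using zeta unfolding ca_def cb_def by (simp add: field_simps)
  qed
  then have "calQ k A \<alpha> = lin (\<lambda>i I. lamP k $ \<alpha> * cb i I + (- (\<zeta> $ \<alpha> / ang \<zeta> (lamP k))) * ca i I) A"
    unfolding calQ_def lin_def by simp
  then show ?thesis unfolding lin_combination cscale_simps(8)[symmetric] by simp
qed

text \<open>The expansion is in the basis \<open>lamtP\<close>, \<xi>; the coefficient of \<xi> is a
  bracket with P, which \<open>sqr_P_leg\<close> turns into x times \<open>ca\<close>.\<close>

lemma calQt_eq: "calQt k A \<alpha> = lamtP k $ \<alpha> *\<^sub>C lin ce A + (x * \<xi> $ \<alpha> / sqr \<xi> (lamtP k)) *\<^sub>C lin ca A"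
proof -
  have "leg_sign i * lamt k i I $ \<alpha> = lamtP k $ \<alpha> * ce i I + (x * \<xi> $ \<alpha> / sqr \<xi> (lamtP k)) * ca i I" for i I
  proof -
    have "lamt k i I $ \<alpha> * sqr \<xi> (lamtP k) = lamtP k $ \<alpha> * sqr \<xi> (lamt k i I) - \<xi> $ \<alpha> * sqr (lamtP k) (lamt k i I)"
      using exhaust_2[of \<alpha>] unfolding sqr_eq by (auto simp: algebra_simps)
    moreover have "leg_sign i * leg_sign i = 1" by (simp add: leg_sign_def)
    ultimately have "leg_sign i * lamt k i I $ \<alpha> * sqr \<xi> (lamtP k) =
        lamtP k $ \<alpha> * (leg_sign i * sqr \<xi> (lamt k i I)) + \<xi> $ \<alpha> * x * ang (lamP k) (lam k i I)"
      unfolding sqr_P_leg by algebra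
    then show ?thesis
      using xi unfolding ca_def ce_def by (simp add: field_simps)
  qed
  then have "calQt k A \<alpha> = lin (\<lambda>i I. lamtP k $ \<alpha> * ce i I + (x * \<xi> $ \<alpha> / sqr \<xi> (lamtP k)) * ca i I) A"
    unfolding calQt_def lin_def by simp
  then show ?thesis unfolding lin_combination by simp
qed

lemma gang_calQ: "gang (calQ k A) (calQ k B) = lin cb A * lin ca B - lin ca A * lin cb B"
  and gang_calQ_calQP: "gang (calQ k A) (calQP k B) = - (lin ca A * etaP B)"
  and gang_calQ_P: "gang (calQ k A) (const_spinor (lamP k)) = - lin ca A"
proof -
  define u where "u \<alpha> = \<zeta> $ \<alpha> / ang \<zeta> (lamP k)" for \<alpha>
  define p where "p \<alpha> = lamP k $ \<alpha>" for \<alpha>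
  \<comment> \<open>The bracket of \<zeta> / <\<zeta> P> with P is 1.\<close>
  have norm: "u 2 * p 1 = 1 + u 1 * p 2"
    using zeta by (simp add: u_def p_def field_simps ang_eq)
  show "gang (calQ k A) (calQ k B) = lin cb A * lin ca B - lin ca A * lin cb B"
    "gang (calQ k A) (calQP k B) = - (lin ca A * etaP B)"
    "gang (calQ k A) (const_spinor (lamP k)) = - lin ca A"
    unfolding gang_eq calQ_eq calQP_def const_spinor_def u_def[symmetric] p_def[symmetric]
    by (simp add: left_diff_distrib right_diff_distrib times_cscale cscale_simps;
        rule grassmann_eqI; simp add: coeff_simps; use norm in algebra)+
qed

lemma gsqr_calQt: "gsqr (calQt k A) (calQt k B) = x *\<^sub>C (lin ca A * lin ce B - lin ce A * lin ca B)"
  and gsqr_calQt_calQtP: "gsqr (calQt k A) (calQtP k B) = x *\<^sub>C (lin ca A * etaP B)"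
  and gsqr_calQt_P: "gsqr (calQt k A) (const_spinor (lamtP k)) = x *\<^sub>C lin ca A"
proof -
  define u where "u \<alpha> = \<xi> $ \<alpha> / sqr \<xi> (lamtP k)" for \<alpha>
  define p where "p \<alpha> = lamtP k $ \<alpha>" for \<alpha>
  have norm: "u 1 * p 2 = 1 + u 2 * p 1"
    using xi by (simp add: u_def p_def field_simps sqr_eq)
  show "gsqr (calQt k A) (calQt k B) = x *\<^sub>C (lin ca A * lin ce B - lin ce A * lin ca B)"
    "gsqr (calQt k A) (calQtP k B) = x *\<^sub>C (lin ca A * etaP B)"
    "gsqr (calQt k A) (const_spinor (lamtP k)) = x *\<^sub>C lin ca A"
    unfolding gsqr_eq calQt_eq calQtP_def const_spinor_def times_divide_eq_right[symmetric]
      u_def[symmetric] p_def[symmetric]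
    by (simp add: distrib_left distrib_right times_cscale cscale_simps;
        rule grassmann_eqI; simp add: coeff_simps; use norm in algebra)+
qed

text \<open>E is the bivector of \<open>Omega\<close>, so the resolution expands it. In the
  covariant forms it stands next to two factors \<open>lin ca\<close>, which remove the terms
  containing \<open>ca\<close> and \<open>cg\<close>.\<close>

lemma E_up_eq: "E_up B C =
  (- 1 / 2) *\<^sub>C (lin cb B * lin ce C - lin ce B * lin cb C + lin ca B * lin cg C - lin cg B * lin ca C)"
proof -
  define q where "q f = (\<Sum>i\<in>UNIV. \<Sum>I\<in>UNIV. \<Sum>j\<in>UNIV. \<Sum>J\<in>UNIV. f i I j J *\<^sub>C (eta i I B * eta j J C))"
    for f :: "2 \<Rightarrow> 2 \<Rightarrow> 2 \<Rightarrow> 2 \<Rightarrow> complex"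
  have lin: "lin u B * lin w C = q (\<lambda>i I j J. u i I * w j J)" for u w
    unfolding lin_def q_def sum_distrib_right
    by (simp only: sum_distrib_left) (simp add: times_cscale cscale_simps mult.commute)
  have add: "q f + q g = q (\<lambda>i I j J. f i I j J + g i I j J)" for f g
    unfolding q_def by (simp add: cscale_add_left sum.distrib)
  have cscale_diff_left: "(z - w) *\<^sub>C F = z *\<^sub>C F - w *\<^sub>C F" for z w and F :: grass
    by (rule grassmann_eqI) (simp add: coeff_simps algebra_simps)
  have diff: "q f - q g = q (\<lambda>i I j J. f i I j J - g i I j J)" for f g
    unfolding q_def by (simp add: cscale_diff_left sum_subtractf)
  have "E_up B C = (- 1 / 2) *\<^sub>C q Omega"
    unfolding E_up_def lg_dot_def q_def Omega_def sum_2 two_values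
    by (rule grassmann_eqI) (simp add: cscale_simps coeff_simps algebra_simps)
  also have "q Omega = lin cb B * lin ce C - lin ce B * lin cb C + lin ca B * lin cg C - lin cg B * lin ca C"
    unfolding lin add diff resolution_of_Omega ..
  finally show ?thesis .
qed

lemma S1_eq_normal:
  assumes "cos \<theta> \<noteq> 0"
  shows "S1 \<theta> k \<zeta> \<xi> = normal_S1 (of_real (cos \<theta>)) (of_real (sin \<theta>)) (lin ca) (lin cb) (lin ce)"
proof -
  define c where "c = complex_of_real (cos \<theta>)"
  define s where "s = complex_of_real (sin \<theta>)"
  have "c \<noteq> 0" using assms by (simp add: c_def)
  then show ?thesis
    unfolding S1_def Let_def assemble_def R_dot_def R_dot_bar_def sum_2 lowerR_eq delta_eq calH_eq calHbar_eq
      normal_S1_def c_def[symmetric] s_def[symmetric]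
    by (simp add: normal_order; intro grassmann_eqI; simp add: coeff_simps; simp add: field_simps power2_eq_square)
qed

lemma S2_eq_normal:
  "S2 m \<theta> k \<zeta> \<xi> = (- x) *\<^sub>C normal_S2 (of_real (cos \<theta>)) (of_real (sin \<theta>)) (lin ca) (lin cb) (lin ce)"
proof -
  define c where "c = complex_of_real (cos \<theta>)"
  define s where "s = complex_of_real (sin \<theta>)"
  show ?thesis
    unfolding S2_def Let_def assemble_def R_dot_def R_dot_bar_def sum_2 lowerR_eq delta_eq calH_eq calHbar_eq
      normal_S2_def c_def[symmetric] s_def[symmetric]
    by (simp add: normal_order; intro grassmann_eqI; simp add: coeff_simps; simp add: field_simps power2_eq_square)
qed

text \<open>The left side does not mention \<zeta> and \<xi>, so this also yields the independence
  of \<open>S1\<close> from them.\<close>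

lemma S1_cov_eq_normal:
  "S1_cov m \<theta> k = normal_S1 (of_real (cos \<theta>)) (of_real (sin \<theta>)) (lin ca) (lin cb) (lin ce)"
proof -
  define c where "c = complex_of_real (cos \<theta>)"
  define s where "s = complex_of_real (sin \<theta>)"
  define y where "y = x"
  have y: "y \<noteq> 0" using xfac_nonzero by (simp add: y_def)
  then show ?thesis
    unfolding S1_cov_def Let_def R_dot_def sum_2 lowerRS_eq lowerR_eq gang_uminus gsqr_uminus
      gang_calQ gang_calQ_calQP gsqr_calQt gsqr_calQt_calQtP E_dn_eq E_up_eq
      normal_S1_def c_def[symmetric] s_def[symmetric] y_def[symmetric]
    by (simp add: normal_order; intro grassmann_eqI; simp add: coeff_simps; simp add: field_simps power2_eq_square)
qed

lemma S2_cov_eq_normal: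
  "S2_cov m \<theta> k = (- x) *\<^sub>C normal_S2 (of_real (cos \<theta>)) (of_real (sin \<theta>)) (lin ca) (lin cb) (lin ce)"
proof -
  define c where "c = complex_of_real (cos \<theta>)"
  define s where "s = complex_of_real (sin \<theta>)"
  define y where "y = x"
  have y: "y \<noteq> 0" using xfac_nonzero by (simp add: y_def)
  then show ?thesis
    unfolding S2_cov_def Let_def R_dot_def sum_2 lowerRS_eq lowerR_eq gang_uminus gsqr_uminus
      gang_calQ gang_calQ_P gang_calQ_calQP gsqr_calQt gsqr_calQt_P gsqr_calQt_calQtP E_dn_eq E_up_eq
      normal_S2_def c_def[symmetric] s_def[symmetric] y_def[symmetric]
    by (simp add: normal_order; intro grassmann_eqI; simp add: coeff_simps; simp add: field_simps power2_eq_square)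
qed

end

section \<open>Little-group covariance\<close>

lemma gsubst_gen:
  assumes "anticommuting \<phi>"
  shows "gsubst \<phi> (gen g) = \<phi> g"
  using gsubst_gen_times[OF assms, of g 1] by (simp add: gsubst_1)

lemma SU2_columns:
  assumes "U \<in> SU2"
  shows "cnj (U $ 1 $ 1) * U $ 1 $ 1 + cnj (U $ 2 $ 1) * U $ 2 $ 1 = 1"
    "cnj (U $ 1 $ 1) * U $ 1 $ 2 + cnj (U $ 2 $ 1) * U $ 2 $ 2 = 0"
    "cnj (U $ 1 $ 2) * U $ 1 $ 1 + cnj (U $ 2 $ 2) * U $ 2 $ 1 = 0"
    "cnj (U $ 1 $ 2) * U $ 1 $ 2 + cnj (U $ 2 $ 2) * U $ 2 $ 2 = 1"
proof -
  have "(\<chi> I J. cnj (U $ J $ I)) ** U = mat 1"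
    using assms matrix_left_right_inverse unfolding SU2_def by blast
  then have eq: "((\<chi> I J. cnj (U $ J $ I)) ** U) $ I $ J = mat 1 $ I $ J" for I J
    by simp
  show "cnj (U $ 1 $ 1) * U $ 1 $ 1 + cnj (U $ 2 $ 1) * U $ 2 $ 1 = 1"
    "cnj (U $ 1 $ 1) * U $ 1 $ 2 + cnj (U $ 2 $ 1) * U $ 2 $ 2 = 0"
    "cnj (U $ 1 $ 2) * U $ 1 $ 1 + cnj (U $ 2 $ 2) * U $ 2 $ 1 = 0"
    "cnj (U $ 1 $ 2) * U $ 1 $ 2 + cnj (U $ 2 $ 2) * U $ 2 $ 2 = 1"
    using eq[of 1 1] eq[of 1 2] eq[of 2 1] eq[of 2 2]
    by (simp_all add: matrix_matrix_mult_def sum_2 mat_def)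
qed

lemma anticommuting_lg_eta: "anticommuting (lg_eta u)"
proof -
  obtain U t where u: "u = (U, t)" by (cases u)
  have "\<exists>w. lg_eta u (Eta (Massive i I) A) = lin w A" for i I A
  proof
    show "lg_eta u (Eta (Massive i I) A) = lin (\<lambda>j J. if j = i then cnj (U i $ I $ J) else 0) A"
      unfolding u lin_def sum_2 using exhaust_2[of i] by (auto simp: sum_2 cscale_simps)
  qed
  then have "\<exists>w. lg_eta u g = lin w A \<or> lg_eta u g = t *\<^sub>C etaP A" if "g = Eta s A" for g s A
    unfolding that by (cases s) (auto simp: u)
  then have form: "\<exists>w A. lg_eta u g = lin w A \<or> lg_eta u g = t *\<^sub>C etaP A" for g
    by (metis gvar.exhaust)
  show ?thesis
    unfolding anticommuting_def
  proof (intro allI)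
    fix g h
    obtain w A where g: "lg_eta u g = lin w A \<or> lg_eta u g = t *\<^sub>C etaP A" using form by blast
    obtain v B where h: "lg_eta u h = lin v B \<or> lg_eta u h = t *\<^sub>C etaP B" using form by blast
    show "lg_eta u g * lg_eta u h = - (lg_eta u h * lg_eta u g)"
      using g h lin_times_lin[of w A v B] etaP_times_etaP[of A B] etaP_times_lin[of A v B] etaP_times_lin[of B w A]
      by (auto simp: times_cscale cscale_simps)
  qed
qed

text \<open>The rotation of the kinematic coefficients by \<open>U\<close> is undone by that of
  \<eta> by the conjugate of \<open>U\<close>, since \<open>U\<close> is unitary; \<open>z\<close>
  collects the \<open>U(1)\<close> weight.\<close>

lemma gsubst_lin:
  assumes "\<And>i. U i \<in> SU2"
  shows "gsubst (lg_eta (U, t)) (lin (\<lambda>i I. z * (\<Sum>J\<in>UNIV. U i $ I $ J * w i J)) A) = z *\<^sub>C lin w A"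
proof -
  have gsubst_eta: "gsubst (lg_eta (U, t)) (eta i I A) = (\<Sum>J\<in>UNIV. cnj (U i $ I $ J) *\<^sub>C eta i J A)" for i I
    unfolding eta_def[of i I] gsubst_gen[OF anticommuting_lg_eta] by simp
  have image: "gsubst (lg_eta (U, t)) (lin v A) =
      lin (\<lambda>i J. cnj (U i $ 1 $ J) * v i 1 + cnj (U i $ 2 $ J) * v i 2) A" for v
    unfolding lin_def sum_2 gsubst_linear gsubst_eta
    by (rule grassmann_eqI) (simp add: coeff_simps algebra_simps)
  have column: "cnj (U i $ 1 $ J) * (z * (U i $ 1 $ 1 * w i 1 + U i $ 1 $ 2 * w i 2)) +
      cnj (U i $ 2 $ J) * (z * (U i $ 2 $ 1 * w i 1 + U i $ 2 $ 2 * w i 2)) = z * w i J" for i J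
  proof -
    have "J = 1 \<or> J = 2" by (rule exhaust_2)
    moreover have "cnj (U i $ 1 $ 1) * (z * (U i $ 1 $ 1 * w i 1 + U i $ 1 $ 2 * w i 2)) +
      cnj (U i $ 2 $ 1) * (z * (U i $ 2 $ 1 * w i 1 + U i $ 2 $ 2 * w i 2)) = z * w i 1"
      using SU2_columns(1,2)[OF assms[of i]] by algebra
    moreover have "cnj (U i $ 1 $ 2) * (z * (U i $ 1 $ 1 * w i 1 + U i $ 1 $ 2 * w i 2)) +
      cnj (U i $ 2 $ 2) * (z * (U i $ 2 $ 1 * w i 1 + U i $ 2 $ 2 * w i 2)) = z * w i 2"
      using SU2_columns(3,4)[OF assms[of i]] by algebra
    ultimately show ?thesis by auto
  qed
  show ?thesis unfolding sum_2 image column by (rule lin_combination)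
qed

text \<open>Rotated brackets and momenta depend on \<open>U\<close> through its determinant 1, and
  the weights of \<open>lamP\<close> and \<open>lamtP\<close> cancel.\<close>

lemma lg_on_shell:
  assumes k: "k \<in> on_shell m" and u: "u \<in> little_group"
  shows "lg_kin u k \<in> on_shell m" 
    and "momentum (lg_kin u k) i \<alpha> \<beta> = momentum k i \<alpha> \<beta>"
proof -
  obtain U t where ut: "u = (U, t)" by (cases u)
  have t: "t \<noteq> 0" and U: "U i \<in> SU2" for i using u by (auto simp: ut little_group_def)
  have det: "U i $ 1 $ 1 * U i $ 2 $ 2 - U i $ 1 $ 2 * U i $ 2 $ 1 = 1" for i
    using U[of i] by (simp add: SU2_def det_2)
  show mom: "momentum (lg_kin u k) i \<alpha> \<beta> = momentum k i \<alpha> \<beta>" for i \<alpha> \<beta>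
    unfolding ut momentum_eq by (simp add: sum_2) (use det[of i] in algebra)
  have ang_u: "ang (lam (lg_kin u k) i I) (lam (lg_kin u k) i J) =
      (U i $ I $ 1 * U i $ J $ 2 - U i $ I $ 2 * U i $ J $ 1) * ang (lam k i 1) (lam k i 2)"
    and sqr_u: "sqr (lamt (lg_kin u k) i I) (lamt (lg_kin u k) i J) =
      (U i $ I $ 1 * U i $ J $ 2 - U i $ I $ 2 * U i $ J $ 1) * sqr (lamt k i 1) (lamt k i 2)" for i I J
    unfolding ut ang_eq sqr_eq by (simp_all add: sum_2 algebra_simps)
  have minor: "U i $ I $ 1 * U i $ J $ 2 - U i $ I $ 2 * U i $ J $ 1 = eps_up I J" for i I J
    using det[of i] exhaust_2[of I] exhaust_2[of J] by (auto simp: two_values algebra_simps)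
  have "ang (lam (lg_kin u k) i I) (lam (lg_kin u k) i J) = - of_real m * eps_up I J"
    "sqr (lamt (lg_kin u k) i I) (lamt (lg_kin u k) i J) = of_real m * eps_up I J" for i I J
    unfolding ang_u sqr_u minor using k by (simp_all add: on_shell_def two_values)
  moreover have "lamP (lg_kin u k) $ \<alpha> * lamtP (lg_kin u k) $ \<beta> = lamP k $ \<alpha> * lamtP k $ \<beta>" for \<alpha> \<beta>
    using t by (simp add: ut)
  moreover have "lamP (lg_kin u k) \<noteq> 0" "lamtP (lg_kin u k) \<noteq> 0"
    using k t by (simp_all add: ut on_shell_def)
  ultimately show "lg_kin u k \<in> on_shell m"
    using k unfolding on_shell_def mem_Collect_eq mom by metis
qed

text \<open>One factor \<open>t\<close> comes from the dotted spinor, the other from moving the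
  inverse weight of \<open>lamP\<close> across the defining equation.\<close>

lemma xfac_lg:
  assumes "m > 0" and k: "k \<in> on_shell m" and u: "(U, t) \<in> little_group"
  shows "xfac m (lg_kin (U, t) k) = t\<^sup>2 * xfac m k"
proof -
  let ?k = "lg_kin (U, t) k"
  have t: "t \<noteq> 0" using u by (auto simp: little_group_def)
  interpret k: three_point m k by unfold_locales fact+
  interpret l: three_point m ?k using lg_on_shell(1)[OF k u] assms(1) by unfold_locales
  have "l.pP \<alpha> = t * k.pP \<alpha>" for \<alpha>
    unfolding l.pP_def k.pP_def lg_on_shell(2)[OF k u] by (simp add: algebra_simps)
  then have "of_real m * (xfac m ?k * (inverse t * lamP k $ \<alpha>)) = t * (of_real m * (xfac m k * lamP k $ \<alpha>))" for \<alpha>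
    using l.xfac[of \<alpha>] unfolding k.xfac by simp
  then have "of_real m * (xfac m ?k * lamP k $ \<alpha>) = of_real m * (t\<^sup>2 * xfac m k * lamP k $ \<alpha>)" for \<alpha>
    using t by (metis (no_types, lifting) mult.assoc mult.left_commute power2_eq_square right_inverse mult_1_left)
  then have "xfac m ?k * lamP k $ \<alpha> = t\<^sup>2 * xfac m k * lamP k $ \<alpha>" for \<alpha>
    using k.mass_nonzero by (metis mult_cancel_left)
  moreover have "lamP k $ 1 \<noteq> 0 \<or> lamP k $ 2 \<noteq> 0"
    using k by (auto simp: on_shell_def vec_eq_iff forall_2)
  ultimately show ?thesis by (metis mult_right_cancel)
qed

section \<open>Contracted R-indices\<close>

lemma R_contracted_0: "0 \<in> R_contracted"
  using R_contracted.intros(3)[OF R_contracted.intros(1), of 0] by (simp add: cscale_simps)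

lemma R_contracted_uminus: "F \<in> R_contracted \<Longrightarrow> - F \<in> R_contracted"
  using R_contracted.intros(3)[of F "- 1"] by (simp add: cscale_minus_1)

lemma R_contracted_diff: "F \<in> R_contracted \<Longrightarrow> G \<in> R_contracted \<Longrightarrow> F - G \<in> R_contracted"
  using R_contracted.intros(4)[OF _ R_contracted_uminus, of F G] by simp

lemma R_contracted_sum: "(\<And>x. x \<in> A \<Longrightarrow> f x \<in> R_contracted) \<Longrightarrow> sum f A \<in> R_contracted"
  by (induction A rule: infinite_finite_induct) (simp_all add: R_contracted_0 R_contracted.intros(4))

lemma parity_gen: "parity True (gen g)"
  using parity_gen_times[of True 1 g] parity_linear(5) by simp

lemma parity_R_contracted: "F \<in> R_contracted \<Longrightarrow> parity False F"
proof (induction rule: R_contracted.induct)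
  case (2 a b)
  show ?case
    unfolding R_contraction_def lowerR_def
    by (intro parity_sum parity_gen_times) (simp add: parity_sum parity_linear parity_gen)
qed (simp_all add: parity_linear parity_times)

text \<open>The R-singlet of two R-vectors with the lowering written out; it is bilinear and extends
  \<open>R_contraction\<close> to linear forms.\<close>

definition lin_contraction :: "(2 \<Rightarrow> grass) \<Rightarrow> (2 \<Rightarrow> grass) \<Rightarrow> grass" where
  "lin_contraction X Y = X 2 * Y 1 - X 1 * Y 2"

lemma lin_contraction_R_contracted:
  "lin_contraction (lin u) (lin w) \<in> R_contracted"
  "lin_contraction (lin u) etaP \<in> R_contracted"
  "lin_contraction etaP etaP \<in> R_contracted"
proof -
  have gen: "lin_contraction (\<lambda>A. gen (Eta a A)) (\<lambda>A. gen (Eta b A)) \<in> R_contracted" for a b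
  proof -
    have "lin_contraction (\<lambda>A. gen (Eta a A)) (\<lambda>A. gen (Eta b A)) = R_contraction a b"
      unfolding lin_contraction_def R_contraction_def sum_2 lowerR_eq by simp
    then show ?thesis by (simp add: R_contracted.intros)
  qed
  have half: "lin_contraction (lin u) (\<lambda>A. gen (Eta b A)) \<in> R_contracted" for b
  proof -
    have "lin_contraction (lin u) (\<lambda>A. gen (Eta b A)) =
        (\<Sum>i\<in>UNIV. \<Sum>I\<in>UNIV. u i I *\<^sub>C lin_contraction (\<lambda>A. gen (Eta (Massive i I) A)) (\<lambda>A. gen (Eta b A)))"
      unfolding lin_contraction_def lin_def eta_def sum_2
      by (rule grassmann_eqI) (simp add: distrib_right times_cscale coeff_simps algebra_simps)
    also have "\<dots> \<in> R_contracted" by (intro R_contracted_sum R_contracted.intros(3) gen)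
    finally show ?thesis .
  qed
  show "lin_contraction (lin u) (lin w) \<in> R_contracted"
  proof -
    have "lin_contraction (lin u) (lin w) =
        (\<Sum>i\<in>UNIV. \<Sum>I\<in>UNIV. w i I *\<^sub>C lin_contraction (lin u) (\<lambda>A. gen (Eta (Massive i I) A)))"
      unfolding lin_contraction_def lin_def[of w] eta_def sum_2
      by (rule grassmann_eqI) (simp add: distrib_left times_cscale coeff_simps algebra_simps)
    also have "\<dots> \<in> R_contracted" by (intro R_contracted_sum R_contracted.intros(3) half)
    finally show ?thesis .
  qed
  show "lin_contraction (lin u) etaP \<in> R_contracted"
    using half unfolding etaP_def .
  show "lin_contraction etaP etaP \<in> R_contracted"
    using gen unfolding etaP_def .
qed

context three_point_reference
begin

lemma normal_R_contracted:
  "normal_S1 c s (lin ca) (lin cb) (lin ce) \<in> R_contracted" "normal_S2 c s (lin ca) (lin cb) (lin ce) \<in> R_contracted"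
proof -
  define aa bb be ee bP eP PP where
    "aa = lin_contraction (lin ca) (lin ca)" "bb = lin_contraction (lin cb) (lin cb)"
    "be = lin_contraction (lin cb) (lin ce)" "ee = lin_contraction (lin ce) (lin ce)"
    "bP = lin_contraction (lin cb) etaP" "eP = lin_contraction (lin ce) etaP"
    "PP = lin_contraction etaP etaP"
  note defs = this
  have mem: "aa \<in> R_contracted" "bb \<in> R_contracted" "be \<in> R_contracted" "ee \<in> R_contracted"
    "bP \<in> R_contracted" "eP \<in> R_contracted" "PP \<in> R_contracted"
    unfolding defs by (rule lin_contraction_R_contracted)+
  note closed = mem R_contracted.intros(1,3,4,5) R_contracted_diff
  \<comment> \<open>The contraction of a block with itself is -2 times the product of its two
    components, which accounts for the powers of 1/2.\<close>
  have "normal_S1 c s (lin ca) (lin cb) (lin ce) = (- 1 / 2) *\<^sub>C aa * ((1 / 2) *\<^sub>C bb + c *\<^sub>C bP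
      + (s / 2) *\<^sub>C (bb * eP) + (1 / 2) *\<^sub>C (PP * (c\<^sup>2 *\<^sub>C 1 - (c * s) *\<^sub>C be - (s\<^sup>2 / 4) *\<^sub>C (bb * ee))))"
    unfolding normal_S1_def defs lin_contraction_def
    by (simp add: normal_order; intro grassmann_eqI; simp add: coeff_simps; simp add: field_simps power2_eq_square)
  also have "\<dots> \<in> R_contracted" by (intro closed)
  finally show "normal_S1 c s (lin ca) (lin cb) (lin ce) \<in> R_contracted" .
  have "normal_S2 c s (lin ca) (lin cb) (lin ce) = (- 1 / 2) *\<^sub>C aa * (s\<^sup>2 *\<^sub>C 1 + (c * s) *\<^sub>C be
      - (c\<^sup>2 / 4) *\<^sub>C (bb * ee) - (c / 2) *\<^sub>C (bP * ee) + s *\<^sub>C eP - (1 / 4) *\<^sub>C (PP * ee))"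
    unfolding normal_S2_def defs lin_contraction_def
    by (simp add: normal_order; intro grassmann_eqI; simp add: coeff_simps; simp add: field_simps power2_eq_square)
  also have "\<dots> \<in> R_contracted" by (intro closed)
  finally show "normal_S2 c s (lin ca) (lin cb) (lin ce) \<in> R_contracted" .
qed

end

section \<open>Little-group weights of the solutions\<close>

lemma gsubst_normal:
  assumes "anticommuting \<phi>" and P: "\<And>A. \<phi> (Eta Massless A) = t *\<^sub>C etaP A" and t: "t \<noteq> 0"
    and D: "\<And>A. gsubst \<phi> (D' A) = inverse t *\<^sub>C D A"
    and H: "\<And>A. gsubst \<phi> (H' A) = t *\<^sub>C H A"
    and B: "\<And>A. gsubst \<phi> (B' A) = inverse t *\<^sub>C B A"
  shows "gsubst \<phi> (normal_S1 c s D' H' B') = normal_S1 c s D H B"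
    "gsubst \<phi> (normal_S2 c s D' H' B') = (inverse t)\<^sup>2 *\<^sub>C normal_S2 c s D H B"
proof -
  have etaP: "gsubst \<phi> (etaP A) = t *\<^sub>C etaP A" for A
    unfolding etaP_def gsubst_gen[OF assms(1)] P by simp
  \<comment> \<open>With weights -1, 1, -1, 1 of \<open>D\<close>, \<open>H\<close>,
    \<open>B\<close>, \<open>etaP\<close>, every term of \<open>normal_S1\<close> has weight 0 and
    every term of \<open>normal_S2\<close> weight -2, the opposite of the weight of x.\<close>
  show "gsubst \<phi> (normal_S1 c s D' H' B') = normal_S1 c s D H B"
    "gsubst \<phi> (normal_S2 c s D' H' B') = (inverse t)\<^sup>2 *\<^sub>C normal_S2 c s D H B"
    unfolding normal_S1_def normal_S2_def
    by (simp add: gsubst_linear gsubst_times[OF assms(1)] gsubst_1 D H B etaP times_cscale cscale_simps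
        distrib_left distrib_right left_diff_distrib right_diff_distrib mult.assoc;
      intro grassmann_eqI; simp add: coeff_simps; use t in \<open>simp add: field_simps power2_eq_square\<close>)+
qed

lemma exists_reference_spinors:
  assumes "k \<in> on_shell m"
  obtains \<zeta> \<xi> where "ang \<zeta> (lamP k) \<noteq> 0" "sqr \<xi> (lamtP k) \<noteq> 0"
proof -
  have "\<exists>\<zeta>. ang \<zeta> v \<noteq> 0" "\<exists>\<zeta>. sqr \<zeta> v \<noteq> 0" if "v \<noteq> 0" for v
  proof -
    have "v $ 1 \<noteq> 0 \<or> v $ 2 \<noteq> 0" using that by (auto simp: vec_eq_iff forall_2)
    then have "ang (axis 2 1) v \<noteq> 0 \<or> ang (axis 1 1) v \<noteq> 0" "sqr (axis 2 1) v \<noteq> 0 \<or> sqr (axis 1 1) v \<noteq> 0"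
      by (auto simp: ang_eq sqr_eq axis_def)
    then show "\<exists>\<zeta>. ang \<zeta> v \<noteq> 0" "\<exists>\<zeta>. sqr \<zeta> v \<noteq> 0" by blast+
  qed
  then show thesis using that assms unfolding on_shell_def by blast
qed

text \<open>The same \<zeta> and \<xi> serve at \<open>k\<close> and at its image; \<open>cb\<close>
  and \<open>ce\<close> acquire their weights from the normalisations <\<zeta> P> and
  [\<xi> P].\<close>

lemma gsubst_cov:
  assumes m: "m > 0" and k: "k \<in> on_shell m" and u: "u \<in> little_group"
  shows "gsubst (lg_eta u) (S1_cov m \<theta> (lg_kin u k)) = S1_cov m \<theta> k"
    "gsubst (lg_eta u) (S2_cov m \<theta> (lg_kin u k)) = S2_cov m \<theta> k"
proof -
  obtain U t where ut: "u = (U, t)" by (cases u)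
  have t: "t \<noteq> 0" and U: "U i \<in> SU2" for i using u by (auto simp: ut little_group_def)
  let ?k = "lg_kin (U, t) k"
  obtain \<zeta> \<xi> where ref: "ang \<zeta> (lamP k) \<noteq> 0" "sqr \<xi> (lamtP k) \<noteq> 0"
    using exists_reference_spinors[OF k] by blast
  have refP: "ang \<zeta> (lamP ?k) = inverse t * ang \<zeta> (lamP k)" "sqr \<xi> (lamtP ?k) = t * sqr \<xi> (lamtP k)"
    by (simp_all add: ang_eq sqr_eq algebra_simps)
  have legs: "ang w (lam ?k i I) = (\<Sum>J\<in>UNIV. U i $ I $ J * ang w (lam k i J))"
    "sqr w (lamt ?k i I) = (\<Sum>J\<in>UNIV. U i $ I $ J * sqr w (lamt k i J))"
    "ang (lamP ?k) w = inverse t * ang (lamP k) w" for w i I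
    by (simp_all add: ang_eq sqr_eq sum_2 algebra_simps)
  interpret k: three_point_reference m k \<zeta> \<xi> using m k ref by unfold_locales
  interpret l: three_point_reference m ?k \<zeta> \<xi>
    using lg_on_shell(1)[OF k u] m t ref unfolding ut by unfold_locales (simp_all only: refP, simp_all)
  have ca: "l.ca = (\<lambda>i I. inverse t * (\<Sum>J\<in>UNIV. U i $ I $ J * k.ca i J))"
    and cb: "l.cb = (\<lambda>i I. t * (\<Sum>J\<in>UNIV. U i $ I $ J * k.cb i J))"
    and ce: "l.ce = (\<lambda>i I. inverse t * (\<Sum>J\<in>UNIV. U i $ I $ J * k.ce i J))"
    unfolding fun_eq_iff l.ca_def k.ca_def l.cb_def k.cb_def l.ce_def k.ce_def refP legs sum_2
    using t ref by (simp_all add: field_simps)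
  have images: "gsubst (lg_eta (U, t)) (lin l.ca A) = inverse t *\<^sub>C lin k.ca A"
    "gsubst (lg_eta (U, t)) (lin l.cb A) = t *\<^sub>C lin k.cb A"
    "gsubst (lg_eta (U, t)) (lin l.ce A) = inverse t *\<^sub>C lin k.ce A" for A
    unfolding ca cb ce by (rule gsubst_lin[OF U])+
  have coeff: "- (t\<^sup>2 * xfac m k) * (inverse t)\<^sup>2 = - xfac m k"
    using t by (simp add: field_simps power2_eq_square)
  note normal = gsubst_normal[OF anticommuting_lg_eta lg_eta.simps(2) t images]
  show "gsubst (lg_eta u) (S1_cov m \<theta> (lg_kin u k)) = S1_cov m \<theta> k"
    "gsubst (lg_eta u) (S2_cov m \<theta> (lg_kin u k)) = S2_cov m \<theta> k"
    unfolding ut l.S1_cov_eq_normal l.S2_cov_eq_normal k.S1_cov_eq_normal k.S2_cov_eq_normal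
      gsubst_linear normal xfac_lg[OF m k u[unfolded ut]]
    unfolding cscale_simps(4) coeff by (rule refl)+
qed

section \<open>The classification\<close>

lemma S_eq_cov:
  assumes "m > 0" "k \<in> on_shell m" "ang \<zeta> (lamP k) \<noteq> 0" "sqr \<xi> (lamtP k) \<noteq> 0" "cos \<theta> \<noteq> 0"
  shows "S1 \<theta> k \<zeta> \<xi> = S1_cov m \<theta> k" "S2 m \<theta> k \<zeta> \<xi> = S2_cov m \<theta> k"
proof -
  interpret three_point_reference m k \<zeta> \<xi> using assms by unfold_locales
  show "S1 \<theta> k \<zeta> \<xi> = S1_cov m \<theta> k" "S2 m \<theta> k \<zeta> \<xi> = S2_cov m \<theta> k"
    unfolding S1_eq_normal[OF assms(5)] S2_eq_normal S1_cov_eq_normal S2_cov_eq_normal by simp_all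
qed

lemma invariants_spanned_by_cov:
  assumes m: "m > 0" and k: "k \<in> on_shell m" and \<theta>: "\<bar>\<theta>\<bar> < pi / 4"
    and F: "\<And>A \<alpha>. supercharge \<theta> k A \<alpha> F = 0 \<and> supercharge_t \<theta> k \<alpha> A F = 0" "F \<in> R_contracted"
  shows "\<exists>z w. F = z *\<^sub>C S1_cov m \<theta> k + w *\<^sub>C S2_cov m \<theta> k"
proof -
  obtain \<zeta> \<xi> where ref: "ang \<zeta> (lamP k) \<noteq> 0" "sqr \<xi> (lamtP k) \<noteq> 0"
    using exists_reference_spinors[OF k] by blast
  interpret three_point_reference m k \<zeta> \<xi> using m k ref by unfold_locales
  let ?c = "complex_of_real (cos \<theta>)" and ?s = "complex_of_real (sin \<theta>)"
  \<comment> \<open>Positivity of the cosine of 2 \<theta> is what makes the determinant c^2 - s^2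
    nonzero.\<close>
  have cos: "cos (2 * \<theta>) > 0" "cos \<theta> > 0" using \<theta> by (auto intro!: cos_gt_zero_pi)
  have "(cos \<theta>)\<^sup>2 \<noteq> (sin \<theta>)\<^sup>2" using cos(1) by (simp add: cos_double)
  then have ne: "?c\<^sup>2 \<noteq> ?s\<^sup>2" unfolding of_real_power[symmetric] of_real_eq_iff by simp
  have one: "?c\<^sup>2 + ?s\<^sup>2 = 1"
    unfolding of_real_power[symmetric] of_real_add[symmetric] by simp
  have c: "?c \<noteq> 0" using cos(2) by simp
  have "kernel_equations ?c ?s F" using F(1) susy_iff_kernel_equations by blast
  then obtain z w where "F = z *\<^sub>C normal_S1 ?c ?s (lin ca) (lin cb) (lin ce) + w *\<^sub>C normal_S2 ?c ?s (lin ca) (lin cb) (lin ce)"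
    using kernel_spanned_by_normal[OF _ parity_R_contracted[OF F(2)] one ne c] by blast
  also have "\<dots> = z *\<^sub>C S1_cov m \<theta> k + (- w / x) *\<^sub>C S2_cov m \<theta> k"
    unfolding S1_cov_eq_normal S2_cov_eq_normal using xfac_nonzero by (simp add: cscale_simps)
  finally show ?thesis by blast
qed

lemma cov_invariant:
  assumes m: "m > 0" and k: "k \<in> on_shell m"
  shows "supercharge \<theta> k A \<alpha> (z *\<^sub>C S1_cov m \<theta> k + w *\<^sub>C S2_cov m \<theta> k) = 0"
    "supercharge_t \<theta> k \<alpha> A (z *\<^sub>C S1_cov m \<theta> k + w *\<^sub>C S2_cov m \<theta> k) = 0"
    "z *\<^sub>C S1_cov m \<theta> k + w *\<^sub>C S2_cov m \<theta> k \<in> R_contracted"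
proof -
  obtain \<zeta> \<xi> where ref: "ang \<zeta> (lamP k) \<noteq> 0" "sqr \<xi> (lamtP k) \<noteq> 0"
    using exists_reference_spinors[OF k] by blast
  interpret three_point_reference m k \<zeta> \<xi> using m k ref by unfold_locales
  let ?F = "z *\<^sub>C S1_cov m \<theta> k + w *\<^sub>C S2_cov m \<theta> k"
  have "(complex_of_real (cos \<theta>))\<^sup>2 + (complex_of_real (sin \<theta>))\<^sup>2 = 1"
    unfolding of_real_power[symmetric] of_real_add[symmetric] by simp
  then have "kernel_equations (of_real (cos \<theta>)) (of_real (sin \<theta>)) ?F"
    unfolding S1_cov_eq_normal S2_cov_eq_normal cscale_simps by (rule kernel_equations_normal)
  then have "\<forall>A \<alpha>. supercharge \<theta> k A \<alpha> ?F = 0 \<and> supercharge_t \<theta> k \<alpha> A ?F = 0"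
    by (simp only: susy_iff_kernel_equations)
  then show "supercharge \<theta> k A \<alpha> ?F = 0" "supercharge_t \<theta> k \<alpha> A ?F = 0" by blast+
  show "?F \<in> R_contracted"
    unfolding S1_cov_eq_normal S2_cov_eq_normal by (intro R_contracted.intros normal_R_contracted)
qed

text \<open>Uniqueness of the coefficients turns invariance of the amplitude into invariance of the
  coefficients.\<close>

lemma cov_independent:
  assumes m: "m > 0" and k: "k \<in> on_shell m" and "cos \<theta> \<noteq> 0"
    and eq: "z *\<^sub>C S1_cov m \<theta> k + w *\<^sub>C S2_cov m \<theta> k = z' *\<^sub>C S1_cov m \<theta> k + w' *\<^sub>C S2_cov m \<theta> k"
  shows "z = z'" "w = w'"
proof -
  obtain \<zeta> \<xi> where ref: "ang \<zeta> (lamP k) \<noteq> 0" "sqr \<xi> (lamtP k) \<noteq> 0"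
    using exists_reference_spinors[OF k] by blast
  interpret three_point_reference m k \<zeta> \<xi> using m k ref by unfold_locales
  let ?n1 = "normal_S1 (of_real (cos \<theta>)) (of_real (sin \<theta>)) (lin ca) (lin cb) (lin ce)"
  let ?n2 = "normal_S2 (of_real (cos \<theta>)) (of_real (sin \<theta>)) (lin ca) (lin cb) (lin ce)"
  have "(z - z') *\<^sub>C ?n1 + ((w' - w) * x) *\<^sub>C ?n2 =
    (z *\<^sub>C ?n1 + w *\<^sub>C (- x) *\<^sub>C ?n2) - (z' *\<^sub>C ?n1 + w' *\<^sub>C (- x) *\<^sub>C ?n2)"
    by (rule grassmann_eqI) (simp add: coeff_simps algebra_simps)
  also have "\<dots> = 0" using eq unfolding S1_cov_eq_normal S2_cov_eq_normal by simp
  finally have "z - z' = 0" "(w' - w) * x = 0"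
    using normal_independent assms(3) of_real_eq_0_iff by blast+
  then show "z = z'" "w = w'" using xfac_nonzero by simp_all
qed

theorem mainTheorem2:
  fixes m Z \<theta> :: real and \<A> :: "kinematics \<Rightarrow> grass"
  assumes "m > 0" and "\<bar>Z\<bar> < 2 * m"
    and "\<bar>\<theta>\<bar> < pi / 4" and "sin (2 * \<theta>) = Z / (2 * m)"
  shows "(lg_invariant m \<A> \<and> susy_invariant m \<theta> \<A> \<and> (\<forall>k\<in>on_shell m. \<A> k \<in> R_contracted) \<longleftrightarrow>
      (\<exists>\<alpha>1 \<alpha>2. lg_invariant_coeff m \<alpha>1 \<and> lg_invariant_coeff m \<alpha>2 \<and>
        (\<forall>k\<in>on_shell m. \<forall>\<zeta> \<xi>. ang \<zeta> (lamP k) \<noteq> 0 \<and> sqr \<xi> (lamtP k) \<noteq> 0 \<longrightarrow>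
          \<A> k = \<alpha>1 k *\<^sub>C S1 \<theta> k \<zeta> \<xi> + \<alpha>2 k *\<^sub>C S2 m \<theta> k \<zeta> \<xi>)))
    \<and> (\<forall>k\<in>on_shell m. \<forall>\<zeta> \<xi>. ang \<zeta> (lamP k) \<noteq> 0 \<and> sqr \<xi> (lamtP k) \<noteq> 0 \<longrightarrow>
          S1 \<theta> k \<zeta> \<xi> = S1_cov m \<theta> k \<and> S2 m \<theta> k \<zeta> \<xi> = S2_cov m \<theta> k)"
    (is "(?inv \<longleftrightarrow> (\<exists>\<alpha>1 \<alpha>2. ?comb \<alpha>1 \<alpha>2)) \<and> ?cov")
proof -
  have "cos \<theta> > 0" using assms(3) by (intro cos_gt_zero_pi) auto
  then have cos: "cos \<theta> \<noteq> 0" by simp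
  have cov: ?cov using S_eq_cov[OF assms(1) _ _ _ cos] by blast
  \<comment> \<open>This replaces the quantification over reference spinors by the covariant forms;
    existence of such spinors keeps the left side from being vacuous.\<close>
  have pointwise: "(\<forall>\<zeta> \<xi>. ang \<zeta> (lamP k) \<noteq> 0 \<and> sqr \<xi> (lamtP k) \<noteq> 0 \<longrightarrow>
        \<A> k = z *\<^sub>C S1 \<theta> k \<zeta> \<xi> + w *\<^sub>C S2 m \<theta> k \<zeta> \<xi>) \<longleftrightarrow>
      \<A> k = z *\<^sub>C S1_cov m \<theta> k + w *\<^sub>C S2_cov m \<theta> k" (is "?l \<longleftrightarrow> ?r") if k: "k \<in> on_shell m" for k z w
  proof
    obtain \<zeta> \<xi> where ref: "ang \<zeta> (lamP k) \<noteq> 0" "sqr \<xi> (lamtP k) \<noteq> 0"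
      using exists_reference_spinors[OF k] by blast
    assume ?l
    then have "\<A> k = z *\<^sub>C S1 \<theta> k \<zeta> \<xi> + w *\<^sub>C S2 m \<theta> k \<zeta> \<xi>" using ref by blast
    then show ?r unfolding S_eq_cov[OF assms(1) k ref cos] .
  next
    assume ?r
    then show ?l by (simp add: S_eq_cov[OF assms(1) k _ _ cos])
  qed
  have comb: "?comb \<alpha>1 \<alpha>2 \<longleftrightarrow> lg_invariant_coeff m \<alpha>1 \<and> lg_invariant_coeff m \<alpha>2 \<and>
      (\<forall>k\<in>on_shell m. \<A> k = \<alpha>1 k *\<^sub>C S1_cov m \<theta> k + \<alpha>2 k *\<^sub>C S2_cov m \<theta> k)" for \<alpha>1 \<alpha>2
    by (intro conj_cong refl ball_cong pointwise)
  have image: "gsubst (lg_eta u) (z *\<^sub>C S1_cov m \<theta> (lg_kin u k) + w *\<^sub>C S2_cov m \<theta> (lg_kin u k)) =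
      z *\<^sub>C S1_cov m \<theta> k + w *\<^sub>C S2_cov m \<theta> k" if "k \<in> on_shell m" "u \<in> little_group" for k u z w
    unfolding gsubst_linear gsubst_cov[OF assms(1) that] ..
  have ?inv if "?comb \<alpha>1 \<alpha>2" for \<alpha>1 \<alpha>2
  proof -
    have lg: "\<alpha>1 (lg_kin u k) = \<alpha>1 k" "\<alpha>2 (lg_kin u k) = \<alpha>2 k" if "k \<in> on_shell m" "u \<in> little_group" for k u
      using \<open>?comb \<alpha>1 \<alpha>2\<close> that unfolding lg_invariant_coeff_def by blast+
    have \<A>: "\<A> k = \<alpha>1 k *\<^sub>C S1_cov m \<theta> k + \<alpha>2 k *\<^sub>C S2_cov m \<theta> k" if "k \<in> on_shell m" for k
      using \<open>?comb \<alpha>1 \<alpha>2\<close> that unfolding comb by blast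
    have "lg_invariant m \<A>"
      unfolding lg_invariant_def
    proof (intro ballI)
      fix k u assume ku: "k \<in> on_shell m" "u \<in> little_group"
      show "gsubst (lg_eta u) (\<A> (lg_kin u k)) = \<A> k"
        unfolding \<A>[OF lg_on_shell(1)[OF ku]] \<A>[OF ku(1)] image[OF ku] lg[OF ku] ..
    qed
    moreover have "susy_invariant m \<theta> \<A>" "\<forall>k\<in>on_shell m. \<A> k \<in> R_contracted"
      unfolding susy_invariant_def by (simp_all add: \<A> cov_invariant[OF assms(1)])
    ultimately show ?thesis by blast
  qed
  moreover have "\<exists>\<alpha>1 \<alpha>2. ?comb \<alpha>1 \<alpha>2" if ?inv
  proof -
    have "\<exists>z w. \<A> k = z *\<^sub>C S1_cov m \<theta> k + w *\<^sub>C S2_cov m \<theta> k" if "k \<in> on_shell m" for k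
      using \<open>?inv\<close> that by (intro invariants_spanned_by_cov assms) (auto simp: susy_invariant_def)
    \<comment> \<open>The coefficients are chosen separately at each kinematic point, so their
      invariance has to be derived afterwards.\<close>
    then obtain \<alpha>1 \<alpha>2 where \<alpha>: "\<A> k = \<alpha>1 k *\<^sub>C S1_cov m \<theta> k + \<alpha>2 k *\<^sub>C S2_cov m \<theta> k" if "k \<in> on_shell m" for k
      by metis
    have "\<alpha>1 (lg_kin u k) = \<alpha>1 k \<and> \<alpha>2 (lg_kin u k) = \<alpha>2 k" if "k \<in> on_shell m" "u \<in> little_group" for k u
    proof -
      have "gsubst (lg_eta u) (\<A> (lg_kin u k)) = \<A> k"
        using \<open>?inv\<close> that by (simp add: lg_invariant_def)
      then show ?thesis
        using cov_independent[OF assms(1) that(1) cos] unfolding \<alpha>[OF lg_on_shell(1)[OF that]] \<alpha>[OF that(1)] image[OF that]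
        by blast
    qed
    then have "?comb \<alpha>1 \<alpha>2" unfolding comb using \<alpha> by (simp add: lg_invariant_coeff_def)
    then show ?thesis by blast
  qed
  ultimately show ?thesis using cov by blast
qed

end
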